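(* Let $M$ be an $n$-dimensional complex manifold. For any Hermitian holomorphic vector bundle $V$ on $M$, any $\eta\in A^{*,*}(V)$ and any $\phi_1,\phi_2\in A^{0,1}(M,T^{1,0}_M)$, there holds $$[\phi_1,\phi_2]\lrcorner\eta=\phi_1\lrcorner\nabla(\phi_2\lrcorner\eta)-\nabla\big(\phi_2\lrcorner(\phi_1\lrcorner\eta)\big)+\phi_2\lrcorner\nabla(\phi_1\lrcorner\eta)-\phi_2\lrcorner(\phi_1\lrcorner\nabla\eta),$$ where $\nabla$ is the Chern connection of the Hermitian holomorphic vector bundle $V$.
   Context: $A^{p,q}(V)=A^{p,q}(M,V)$ is the space of smooth $(p,q)$-forms on $M$ with coefficients in $V$; $A^{*,*}$ means arbitrary bidegree. The Chern connection is extended to $V$-valued forms by $\nabla(\tau\otimes s)=d\tau\otimes s+(-1)^k\tau\wedge\nabla s$ for a $k$-form $\tau$ and a smooth section $s$ of $V$. In local holomorphic coordinates $z^1,\dots,z^n$ write $\partial_i=\partial/\partial z^i$. Bracket: for $\varphi=\sum_i\varphi^i\otimes\partial_i$ and $\psi=\sum_i\psi^i\otimes\partial_i$ in $A^{0,1}(M,T^{1,0}_M)$ (so $\varphi^i,\psi^i$ are local $(0,1)$-forms), $$[\varphi,\psi]=\sum_{i,j=1}^n\big(\varphi^i\wedge\partial_i\psi^j+\psi^i\wedge\partial_i\varphi^j\big)\otimes\partial_j\in A^{0,2}(M,T^{1,0}_M),$$ where $\partial_i\varphi^j$ is obtained by applying $\partial_i$ to the coefficients of $\varphi^j$ with respect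 to $d\bar z^1,\dots,d\bar z^n$. Contraction: for $\varphi=\sum_i\varphi^i\otimes\partial_i\in A^{0,q}(M,T^{1,0}_M)$ and a form $\omega$, $\varphi\lrcorner\omega=\sum_i\varphi^i\wedge(\partial_i\lrcorner\omega)$, and $\varphi\lrcorner(\omega\otimes s)=(\varphi\lrcorner\omega)\otimes s$. *)

theory Defs
  imports "HOL-Analysis.Analysis" "HOL-Library.Function_Algebras"
begin

text \<open>
  Sums, differences and zero of functions are pointwise (theory Function_Algebras).  All differential
  forms below are functions, so \<open>\<omega> + \<theta>\<close>, \<open>\<omega> - \<theta>\<close> and finite sums of forms have their usual meaning.
\<close>

section \<open>Smooth and holomorphic functions on open subsets of complex Euclidean space\<close>

primrec Ck_on :: "nat \<Rightarrow> 'a::real_normed_vector set \<Rightarrow> ('a \<Rightarrow> 'b::real_normed_vector) \<Rightarrow> bool" where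
  "Ck_on 0 S f \<longleftrightarrow> continuous_on S f"
| "Ck_on (Suc k) S f \<longleftrightarrow>
     (\<forall>x\<in>S. f differentiable (at x)) \<and> (\<forall>v. Ck_on k S (\<lambda>x. frechet_derivative f (at x) v))"

definition smooth_on :: "'a::real_normed_vector set \<Rightarrow> ('a \<Rightarrow> 'b::real_normed_vector) \<Rightarrow> bool" where
  "smooth_on S f \<longleftrightarrow> (\<forall>k. Ck_on k S f)"

text \<open>
  \<open>Hol i\<close> stands for the coordinate \<open>z\<^sup>i\<close> (so for \<open>\<partial>/\<partial>z\<^sup>i\<close> and \<open>dz\<^sup>i\<close>), and \<open>Anti i\<close> for its complex
  conjugate.  They are ordered with all \<open>dz\<^sup>i\<close> before all conjugates; the order only serves to
  write down a basis of the exterior algebra.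
\<close>

datatype 'n cidx = Hol 'n | Anti 'n

fun bar :: "'n cidx \<Rightarrow> 'n cidx" where
  "bar (Hol i) = Anti i"
| "bar (Anti i) = Hol i"

instance cidx :: (finite) finite
proof
  have "(UNIV :: 'a cidx set) \<subseteq> range Hol \<union> range Anti"
  proof
    fix a :: "'a cidx"
    show "a \<in> range Hol \<union> range Anti" by (cases a) auto
  qed
  then show "finite (UNIV :: 'a cidx set)"
    by (rule finite_subset) simp
qed

instantiation cidx :: (linorder) linorder
begin

definition less_eq_cidx :: "'a cidx \<Rightarrow> 'a cidx \<Rightarrow> bool" where
  "a \<le> b \<longleftrightarrow> (case a of Hol i \<Rightarrow> (case b of Hol j \<Rightarrow> i \<le> j | Anti j \<Rightarrow> True)
                       | Anti i \<Rightarrow> (case b of Hol j \<Rightarrow> False | Anti j \<Rightarrow> i \<le> j))"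

definition less_cidx :: "'a cidx \<Rightarrow> 'a cidx \<Rightarrow> bool" where
  "a < b \<longleftrightarrow> a \<le> b \<and> \<not> b \<le> (a :: 'a cidx)"

instance
  by standard (auto simp: less_eq_cidx_def less_cidx_def split: cidx.splits)

end

definition wirtinger ::
  "'n::finite cidx \<Rightarrow> (complex ^ 'n \<Rightarrow> complex) \<Rightarrow> complex ^ 'n \<Rightarrow> complex" where
  "wirtinger a f z = (let f' = frechet_derivative f (at z) in
     case a of Hol i \<Rightarrow> (f' (axis i 1) - \<i> * f' (axis i \<i>)) / 2
             | Anti i \<Rightarrow> (f' (axis i 1) + \<i> * f' (axis i \<i>)) / 2)"

definition hol_on :: "(complex ^ 'n::finite) set \<Rightarrow> (complex ^ 'n \<Rightarrow> complex) \<Rightarrow> bool" where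
  "hol_on S f \<longleftrightarrow> smooth_on S f \<and> (\<forall>z\<in>S. \<forall>j. wirtinger (Anti j) f z = 0)"

section \<open>The exterior algebra of the complexified cotangent space\<close>

text \<open>
  \<open>\<omega> S\<close> is the coefficient of \<open>\<omega>\<close> at the basis element indexed by \<open>S\<close>, the wedge product of the
  generators \<open>dz\<^sup>i\<close> (for \<open>Hol i \<in> S\<close>) and their conjugates (for \<open>Anti i \<in> S\<close>) in increasing order.
\<close>

type_synonym 'n ext = "'n cidx set \<Rightarrow> complex"

definition scl :: "complex \<Rightarrow> 'n ext \<Rightarrow> 'n ext" where
  "scl c \<omega> = (\<lambda>S. c * \<omega> S)"

definition scalar :: "complex \<Rightarrow> 'n ext" where
  "scalar c = (\<lambda>S. if S = {} then c else 0)"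

definition gen :: "'n cidx \<Rightarrow> 'n ext" where
  "gen a = (\<lambda>S. if S = {a} then 1 else 0)"

text \<open>The sign of the permutation that sorts the elements of \<open>A\<close> followed by those of \<open>B\<close>
  (for disjoint \<open>A\<close> and \<open>B\<close>).\<close>

definition shuffle_sign :: "'n::{finite,linorder} cidx set \<Rightarrow> 'n cidx set \<Rightarrow> complex" where
  "shuffle_sign A B = (-1) ^ card {(a, b). a \<in> A \<and> b \<in> B \<and> b < a}"

definition wedge :: "'n::{finite,linorder} ext \<Rightarrow> 'n ext \<Rightarrow> 'n ext" (infixr "\<and>\<^sub>w" 70) where
  "\<alpha> \<and>\<^sub>w \<beta> = (\<lambda>S. \<Sum>A\<in>Pow S. shuffle_sign A (S - A) * \<alpha> A * \<beta> (S - A))"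

text \<open>Contraction with the coordinate vector field belonging to \<open>a\<close>: the antiderivation that sends
  \<open>gen a\<close> to 1 and the other generators to 0.\<close>

definition iprod :: "'n::{finite,linorder} cidx \<Rightarrow> 'n ext \<Rightarrow> 'n ext" where
  "iprod a \<omega> = (\<lambda>S. if a \<in> S then 0 else shuffle_sign {a} S * \<omega> (insert a S))"

text \<open>The algebra homomorphism that sends the generator \<open>gen a\<close> to the 1-form \<open>f a\<close>.\<close>

definition subst_gen :: "('n::{finite,linorder} cidx \<Rightarrow> 'n ext) \<Rightarrow> 'n ext \<Rightarrow> 'n ext" where
  "subst_gen f \<omega> =
     (\<Sum>S\<in>UNIV. scl (\<omega> S) (foldr (\<and>\<^sub>w) (map f (sorted_list_of_set S)) (scalar 1)))"

text \<open>Pullback along a holomorphic map with complex Jacobian matrix \<open>J\<close>.\<close>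

definition pull :: "complex ^ 'n::{finite,linorder} ^ 'n::{finite,linorder} \<Rightarrow> 'n ext \<Rightarrow> 'n ext" where
  "pull J = subst_gen (\<lambda>a. case a of
      Hol i \<Rightarrow> (\<Sum>j\<in>UNIV. scl (J $ i $ j) (gen (Hol j)))
    | Anti i \<Rightarrow> (\<Sum>j\<in>UNIV. scl (cnj (J $ i $ j)) (gen (Anti j))))"

definition conj_ext :: "'n::{finite,linorder} ext \<Rightarrow> 'n ext" where
  "conj_ext \<omega> = subst_gen (\<lambda>a. gen (bar a)) (\<lambda>S. cnj (\<omega> S))"

definition ext_deg :: "nat \<Rightarrow> 'n ext set" where
  "ext_deg k = {\<omega>. \<forall>S. \<omega> S \<noteq> 0 \<longrightarrow> card S = k}"

definition ext_bideg :: "nat \<Rightarrow> nat \<Rightarrow> 'n ext set" where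
  "ext_bideg p q = {\<omega>. \<forall>S. \<omega> S \<noteq> 0 \<longrightarrow> card {i. Hol i \<in> S} = p \<and> card {i. Anti i \<in> S} = q}"

definition bideg_part :: "nat \<Rightarrow> nat \<Rightarrow> 'n ext \<Rightarrow> 'n ext" where
  "bideg_part p q \<omega> =
     (\<lambda>S. if card {i. Hol i \<in> S} = p \<and> card {i. Anti i \<in> S} = q then \<omega> S else 0)"

section \<open>Complex manifolds\<close>

text \<open>The manifold is the whole (topological) type \<open>'m\<close>; its complex structure is given by an atlas.
  A chart is a pair of its domain and its coordinate map, which is only relevant on the domain.\<close>

type_synonym ('m, 'n) chart = "'m set \<times> ('m \<Rightarrow> complex ^ 'n)"

abbreviation cdom :: "'m set \<times> 'b \<Rightarrow> 'm set" where
  "cdom \<equiv> fst"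

definition loc :: "('m, 'n::finite) chart \<Rightarrow> ('m \<Rightarrow> complex) \<Rightarrow> complex ^ 'n \<Rightarrow> complex" where
  "loc c f = f \<circ> inv_into (cdom c) (snd c)"

text \<open>Derivative of a function on the manifold along a coordinate vector field of the chart \<open>c\<close>.\<close>

definition cdiff ::
  "('m, 'n::finite) chart \<Rightarrow> 'n cidx \<Rightarrow> ('m \<Rightarrow> complex) \<Rightarrow> 'm \<Rightarrow> complex" where
  "cdiff c a f x = wirtinger a (loc c f) (snd c x)"

definition smooth_fun :: "('m, 'n::finite) chart set \<Rightarrow> 'm set \<Rightarrow> ('m \<Rightarrow> complex) \<Rightarrow> bool" where
  "smooth_fun \<A> U f \<longleftrightarrow> (\<forall>c\<in>\<A>. smooth_on (snd c ` (U \<inter> cdom c)) (loc c f))"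

definition hol_fun :: "('m, 'n::finite) chart set \<Rightarrow> 'm set \<Rightarrow> ('m \<Rightarrow> complex) \<Rightarrow> bool" where
  "hol_fun \<A> U f \<longleftrightarrow> (\<forall>c\<in>\<A>. hol_on (snd c ` (U \<inter> cdom c)) (loc c f))"

definition complex_manifold :: "('m::topological_space, 'n::finite) chart set \<Rightarrow> bool" where
  "complex_manifold \<A> \<longleftrightarrow>
     (\<Union>c\<in>\<A>. cdom c) = UNIV \<and>
     (\<forall>c\<in>\<A>. open (cdom c) \<and> open (snd c ` cdom c) \<and>
        homeomorphism (cdom c) (snd c ` cdom c) (snd c) (inv_into (cdom c) (snd c))) \<and>
     (\<forall>c\<in>\<A>. \<forall>i. hol_fun \<A> (cdom c) (\<lambda>x. snd c x $ i))"

text \<open>The complex Jacobian matrix at \<open>x\<close> of the coordinates of \<open>c'\<close> with respect to those of \<open>c\<close>.\<close>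

definition jacobian :: "('m, 'n::finite) chart \<Rightarrow> ('m, 'n) chart \<Rightarrow> 'm \<Rightarrow> complex ^ 'n ^ 'n" where
  "jacobian c c' x = (\<chi> i j. cdiff c (Hol j) (\<lambda>y. snd c' y $ i) x)"

section \<open>Differential forms\<close>

text \<open>
  A form \<open>\<omega>\<close> on an open set is the family of its coordinate expressions: \<open>\<omega> c x S\<close> is its coefficient
  at the point \<open>x\<close> with respect to the coordinates of \<open>c\<close>.  These expressions transform into each other by
  pullback, and are set to 0 wherever they make no sense, so that two forms on an open set agree iff they are
  equal as functions.  The set \<open>L\<close> prescribes the (bi)degree.
\<close>

type_synonym ('m, 'n) form = "('m, 'n) chart \<Rightarrow> 'm \<Rightarrow> 'n ext"

definition smooth_ext :: "('m, 'n::finite) chart \<Rightarrow> 'm set \<Rightarrow> ('m \<Rightarrow> 'n ext) \<Rightarrow> bool" where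
  "smooth_ext c U \<alpha> \<longleftrightarrow> (\<forall>S. smooth_on (snd c ` (U \<inter> cdom c)) (loc c (\<lambda>x. \<alpha> x S)))"

definition forms ::
  "('m, 'n::{finite,linorder}) chart set \<Rightarrow> 'm set \<Rightarrow> 'n ext set \<Rightarrow> ('m, 'n) form set" where
  "forms \<A> U L = {\<omega>.
     (\<forall>c x. c \<notin> \<A> \<or> x \<notin> U \<inter> cdom c \<longrightarrow> \<omega> c x = 0) \<and>
     (\<forall>c x. \<omega> c x \<in> L) \<and>
     (\<forall>c\<in>\<A>. smooth_ext c U (\<omega> c)) \<and>
     (\<forall>c\<in>\<A>. \<forall>c'\<in>\<A>. \<forall>x\<in>U \<inter> cdom c \<inter> cdom c'. \<omega> c x = pull (jacobian c c' x) (\<omega> c' x))}"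

text \<open>The coefficientwise derivative of a local expression along a coordinate vector field.\<close>

definition ext_diff ::
  "('m, 'n::finite) chart \<Rightarrow> 'n cidx \<Rightarrow> ('m \<Rightarrow> 'n ext) \<Rightarrow> 'm \<Rightarrow> 'n ext" where
  "ext_diff c a \<alpha> x = (\<lambda>S. cdiff c a (\<lambda>y. \<alpha> y S) x)"

definition ext_d ::
  "('m, 'n::{finite,linorder}) chart set \<Rightarrow> 'm set \<Rightarrow> ('m, 'n) form \<Rightarrow> ('m, 'n) form" where
  "ext_d \<A> U \<omega> = (\<lambda>c x. if c \<in> \<A> \<and> x \<in> U \<inter> cdom c
     then \<Sum>a\<in>UNIV. gen a \<and>\<^sub>w ext_diff c a (\<omega> c) x else 0)"

text \<open>Forms of type \<open>(0,q)\<close> with values in the holomorphic tangent bundle: \<open>\<phi> c x i\<close> is the \<open>i\<close>-th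
  component of \<open>\<phi>\<close> with respect to the frame \<open>\<partial>/\<partial>z\<^sup>1, \<dots>, \<partial>/\<partial>z\<^sup>n\<close> of the chart \<open>c\<close>.\<close>

type_synonym ('m, 'n) tform = "('m, 'n) chart \<Rightarrow> 'm \<Rightarrow> 'n \<Rightarrow> 'n ext"

definition tforms ::
  "('m, 'n::{finite,linorder}) chart set \<Rightarrow> 'm set \<Rightarrow> nat \<Rightarrow> ('m, 'n) tform set" where
  "tforms \<A> U q = {\<phi>.
     (\<forall>c x i. c \<notin> \<A> \<or> x \<notin> U \<inter> cdom c \<longrightarrow> \<phi> c x i = 0) \<and>
     (\<forall>c x i. \<phi> c x i \<in> ext_bideg 0 q) \<and>
     (\<forall>c\<in>\<A>. \<forall>i. smooth_ext c U (\<lambda>x. \<phi> c x i)) \<and>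
     (\<forall>c\<in>\<A>. \<forall>c'\<in>\<A>. \<forall>x\<in>U \<inter> cdom c \<inter> cdom c'. \<forall>i.
        pull (jacobian c c' x) (\<phi> c' x i) =
          (\<Sum>j\<in>UNIV. scl (jacobian c c' x $ i $ j) (\<phi> c x j)))}"

definition bracket ::
  "('m, 'n::{finite,linorder}) tform \<Rightarrow> ('m, 'n) tform \<Rightarrow> ('m, 'n) tform" where
  "bracket \<phi> \<psi> = (\<lambda>c x j. \<Sum>i\<in>UNIV.
     \<phi> c x i \<and>\<^sub>w ext_diff c (Hol i) (\<lambda>y. \<psi> c y j) x +
     \<psi> c x i \<and>\<^sub>w ext_diff c (Hol i) (\<lambda>y. \<phi> c y j) x)"

section \<open>Holomorphic vector bundles and vector-valued forms\<close>

text \<open>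
  A bundle with total space \<open>'e\<close> and projection \<open>\<pi>\<close> is given by local trivializations: pairs of an open set
  and a map from the total space to the standard fibre \<open>complex ^ 'r\<close>.  The transition functions are linear
  on the fibres, so each fibre gets its vector space structure from the trivializations; they depend
  holomorphically on the base point, so the total space gets its complex structure in the same way.
\<close>

type_synonym ('m, 'e, 'r) triv = "'m set \<times> ('e \<Rightarrow> complex ^ 'r)"

text \<open>The element of the fibre over \<open>x\<close> with coordinates \<open>v\<close> in the trivialization \<open>t\<close>.\<close>

definition lift :: "('e \<Rightarrow> 'm) \<Rightarrow> ('m, 'e, 'r::finite) triv \<Rightarrow> 'm \<Rightarrow> complex ^ 'r \<Rightarrow> 'e" where
  "lift \<pi> t x v = (THE e. \<pi> e = x \<and> snd t e = v)"

definition transition ::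
  "('e \<Rightarrow> 'm) \<Rightarrow> ('m, 'e, 'r::finite) triv \<Rightarrow> ('m, 'e, 'r) triv \<Rightarrow> 'm \<Rightarrow> complex ^ 'r ^ 'r" where
  "transition \<pi> t t' x = matrix (\<lambda>v. snd t' (lift \<pi> t x v))"

definition holomorphic_bundle ::
  "('m::topological_space, 'n::finite) chart set \<Rightarrow> ('e \<Rightarrow> 'm) \<Rightarrow> ('m, 'e, 'r::finite) triv set
     \<Rightarrow> bool" where
  "holomorphic_bundle \<A> \<pi> \<T> \<longleftrightarrow>
     (\<Union>t\<in>\<T>. cdom t) = UNIV \<and>
     (\<forall>t\<in>\<T>. open (cdom t) \<and>
        bij_betw (\<lambda>e. (\<pi> e, snd t e)) (\<pi> -` cdom t) (cdom t \<times> UNIV)) \<and>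
     (\<forall>t\<in>\<T>. \<forall>t'\<in>\<T>.
        (\<forall>e. \<pi> e \<in> cdom t \<inter> cdom t' \<longrightarrow> snd t' e = transition \<pi> t t' (\<pi> e) *v snd t e) \<and>
        (\<forall>a b. hol_fun \<A> (cdom t \<inter> cdom t') (\<lambda>x. transition \<pi> t t' x $ a $ b)))"

text \<open>The metric is linear in its first and antilinear in its second argument; \<open>h\<close> is only relevant for
  pairs of elements of the same fibre.\<close>

definition gram ::
  "('e \<Rightarrow> 'm) \<Rightarrow> ('e \<Rightarrow> 'e \<Rightarrow> complex) \<Rightarrow> ('m, 'e, 'r::finite) triv \<Rightarrow> 'm \<Rightarrow> 'r \<Rightarrow> 'r \<Rightarrow> complex"
  where
  "gram \<pi> h t x a b = h (lift \<pi> t x (axis a 1)) (lift \<pi> t x (axis b 1))"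

definition hermitian_metric ::
  "('m::topological_space, 'n::finite) chart set \<Rightarrow> ('e \<Rightarrow> 'm) \<Rightarrow> ('m, 'e, 'r::finite) triv set
     \<Rightarrow> ('e \<Rightarrow> 'e \<Rightarrow> complex) \<Rightarrow> bool" where
  "hermitian_metric \<A> \<pi> \<T> h \<longleftrightarrow> (\<forall>t\<in>\<T>.
     (\<forall>x\<in>cdom t. let H = (\<lambda>v w. h (lift \<pi> t x v) (lift \<pi> t x w)) in
        (\<forall>u v w. H (u + v) w = H u w + H v w) \<and>
        (\<forall>k v w. H (k *s v) w = k * H v w) \<and>
        (\<forall>v w. H w v = cnj (H v w)) \<and>
        (\<forall>v. v \<noteq> 0 \<longrightarrow> 0 < Re (H v v))) \<and>
     (\<forall>a b. smooth_fun \<A> (cdom t) (\<lambda>x. gram \<pi> h t x a b)))"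

text \<open>For a \<open>V\<close>-valued form \<open>\<eta>\<close>, \<open>\<eta> c t x a\<close> is the expression in the chart \<open>c\<close> of the \<open>a\<close>-th
  component of \<open>\<eta>\<close> with respect to the holomorphic frame given by the trivialization \<open>t\<close>.  In
  particular, the smooth sections of \<open>V\<close> are the \<open>V\<close>-valued forms of degree 0.\<close>

type_synonym ('m, 'n, 'e, 'r) vform =
  "('m, 'n) chart \<Rightarrow> ('m, 'e, 'r) triv \<Rightarrow> 'm \<Rightarrow> 'r \<Rightarrow> 'n ext"

definition vforms ::
  "('m, 'n::{finite,linorder}) chart set \<Rightarrow> ('e \<Rightarrow> 'm) \<Rightarrow> ('m, 'e, 'r::finite) triv set
     \<Rightarrow> 'm set \<Rightarrow> 'n ext set \<Rightarrow> ('m, 'n, 'e, 'r) vform set" where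
  "vforms \<A> \<pi> \<T> U L = {\<eta>.
     (\<forall>c t x a. t \<notin> \<T> \<longrightarrow> \<eta> c t x a = 0) \<and>
     (\<forall>t\<in>\<T>. \<forall>a. (\<lambda>c x. \<eta> c t x a) \<in> forms \<A> (U \<inter> cdom t) L) \<and>
     (\<forall>c\<in>\<A>. \<forall>t\<in>\<T>. \<forall>t'\<in>\<T>. \<forall>x\<in>U \<inter> cdom c \<inter> cdom t \<inter> cdom t'. \<forall>a.
        \<eta> c t' x a = (\<Sum>b\<in>UNIV. scl (transition \<pi> t t' x $ a $ b) (\<eta> c t x b)))}"

definition vrestrict :: "'m set \<Rightarrow> ('m, 'n, 'e, 'r) vform \<Rightarrow> ('m, 'n, 'e, 'r) vform" where
  "vrestrict W \<eta> = (\<lambda>c t x a. if x \<in> W then \<eta> c t x a else 0)"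

text \<open>The product of a scalar form and a \<open>V\<close>-valued form; for a section \<open>s\<close>, \<open>vwedge \<tau> s\<close> is \<open>\<tau> \<otimes> s\<close>.\<close>

definition vwedge ::
  "('m, 'n::{finite,linorder}) form \<Rightarrow> ('m, 'n, 'e, 'r) vform \<Rightarrow> ('m, 'n, 'e, 'r) vform" where
  "vwedge \<tau> \<eta> = (\<lambda>c t x a. \<tau> c x \<and>\<^sub>w \<eta> c t x a)"

definition contract ::
  "('m, 'n::{finite,linorder}) tform \<Rightarrow> ('m, 'n, 'e, 'r) vform \<Rightarrow> ('m, 'n, 'e, 'r) vform" where
  "contract \<phi> \<eta> = (\<lambda>c t x a. \<Sum>i\<in>UNIV. \<phi> c x i \<and>\<^sub>w iprod (Hol i) (\<eta> c t x a))"

section \<open>The Chern connection\<close>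

text \<open>A connection is a homomorphism of sheaves on the manifold from the smooth sections of \<open>V\<close> to the
  \<open>V\<close>-valued 1-forms that satisfies the Leibniz rule; \<open>D U\<close> is its action over the open set \<open>U\<close>.\<close>

definition connection ::
  "('m::topological_space, 'n::{finite,linorder}) chart set \<Rightarrow> ('e \<Rightarrow> 'm)
     \<Rightarrow> ('m, 'e, 'r::finite) triv set
     \<Rightarrow> ('m set \<Rightarrow> ('m, 'n, 'e, 'r) vform \<Rightarrow> ('m, 'n, 'e, 'r) vform) \<Rightarrow> bool" where
  "connection \<A> \<pi> \<T> D \<longleftrightarrow> (\<forall>U. open U \<longrightarrow>
     (\<forall>s\<in>vforms \<A> \<pi> \<T> U (ext_deg 0). D U s \<in> vforms \<A> \<pi> \<T> U (ext_deg 1)) \<and>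
     (\<forall>s\<in>vforms \<A> \<pi> \<T> U (ext_deg 0). \<forall>s'\<in>vforms \<A> \<pi> \<T> U (ext_deg 0).
        D U (s + s') = D U s + D U s') \<and>
     (\<forall>s\<in>vforms \<A> \<pi> \<T> U (ext_deg 0). \<forall>W. open W \<and> W \<subseteq> U \<longrightarrow>
        D W (vrestrict W s) = vrestrict W (D U s)) \<and>
     (\<forall>f\<in>forms \<A> U (ext_deg 0). \<forall>s\<in>vforms \<A> \<pi> \<T> U (ext_deg 0).
        D U (vwedge f s) = vwedge (ext_d \<A> U f) s + vwedge f (D U s)))"

text \<open>The sesquilinear pairing of \<open>V\<close>-valued forms with values in scalar forms that extends the metric,
  computed in the trivialization \<open>t\<close>.\<close>

definition herm ::
  "('e \<Rightarrow> 'm) \<Rightarrow> ('e \<Rightarrow> 'e \<Rightarrow> complex) \<Rightarrow> ('m, 'e, 'r::finite) triv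
     \<Rightarrow> ('m, 'n::{finite,linorder}, 'e, 'r) vform \<Rightarrow> ('m, 'n, 'e, 'r) vform \<Rightarrow> ('m, 'n) form" where
  "herm \<pi> h t \<eta> \<zeta> = (\<lambda>c x. \<Sum>a\<in>UNIV. \<Sum>b\<in>UNIV.
     scl (gram \<pi> h t x a b) (\<eta> c t x a \<and>\<^sub>w conj_ext (\<zeta> c t x b)))"

definition metric_compatible ::
  "('m::topological_space, 'n::{finite,linorder}) chart set \<Rightarrow> ('e \<Rightarrow> 'm)
     \<Rightarrow> ('m, 'e, 'r::finite) triv set \<Rightarrow> ('e \<Rightarrow> 'e \<Rightarrow> complex)
     \<Rightarrow> ('m set \<Rightarrow> ('m, 'n, 'e, 'r) vform \<Rightarrow> ('m, 'n, 'e, 'r) vform) \<Rightarrow> bool" where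
  "metric_compatible \<A> \<pi> \<T> h D \<longleftrightarrow> (\<forall>t\<in>\<T>. \<forall>U. open U \<and> U \<subseteq> cdom t \<longrightarrow>
     (\<forall>s\<in>vforms \<A> \<pi> \<T> U (ext_deg 0). \<forall>s'\<in>vforms \<A> \<pi> \<T> U (ext_deg 0).
        ext_d \<A> U (herm \<pi> h t s s') = herm \<pi> h t (D U s) s' + herm \<pi> h t s (D U s')))"

text \<open>The Dolbeault operator of \<open>V\<close> acts componentwise in holomorphic frames.\<close>

definition vdbar ::
  "('m, 'n::{finite,linorder}) chart set \<Rightarrow> ('m, 'e, 'r) triv set \<Rightarrow> 'm set
     \<Rightarrow> ('m, 'n, 'e, 'r) vform \<Rightarrow> ('m, 'n, 'e, 'r) vform" where
  "vdbar \<A> \<T> U \<eta> = (\<lambda>c t x a. if c \<in> \<A> \<and> t \<in> \<T> \<and> x \<in> U \<inter> cdom c \<inter> cdom t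
     then \<Sum>i\<in>UNIV. gen (Anti i) \<and>\<^sub>w ext_diff c (Anti i) (\<lambda>y. \<eta> c t y a) x else 0)"

definition holomorphic_compatible ::
  "('m::topological_space, 'n::{finite,linorder}) chart set \<Rightarrow> ('e \<Rightarrow> 'm)
     \<Rightarrow> ('m, 'e, 'r::finite) triv set
     \<Rightarrow> ('m set \<Rightarrow> ('m, 'n, 'e, 'r) vform \<Rightarrow> ('m, 'n, 'e, 'r) vform) \<Rightarrow> bool" where
  "holomorphic_compatible \<A> \<pi> \<T> D \<longleftrightarrow> (\<forall>U. open U \<longrightarrow>
     (\<forall>s\<in>vforms \<A> \<pi> \<T> U (ext_deg 0).
        (\<lambda>c t x a. bideg_part 0 1 (D U s c t x a)) = vdbar \<A> \<T> U s))"

definition chern_connection ::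
  "('m::topological_space, 'n::{finite,linorder}) chart set \<Rightarrow> ('e \<Rightarrow> 'm)
     \<Rightarrow> ('m, 'e, 'r::finite) triv set \<Rightarrow> ('e \<Rightarrow> 'e \<Rightarrow> complex)
     \<Rightarrow> ('m set \<Rightarrow> ('m, 'n, 'e, 'r) vform \<Rightarrow> ('m, 'n, 'e, 'r) vform) \<Rightarrow> bool" where
  "chern_connection \<A> \<pi> \<T> h D \<longleftrightarrow>
     connection \<A> \<pi> \<T> D \<and> metric_compatible \<A> \<pi> \<T> h D \<and> holomorphic_compatible \<A> \<pi> \<T> D"

text \<open>\<open>N\<close> is the extension of the connection \<open>D\<close> to \<open>V\<close>-valued forms of all degrees.  Every \<open>V\<close>-valued
  form is locally a finite sum of products \<open>\<tau> \<otimes> s\<close>, so the sheaf homomorphism \<open>N\<close> is determined by the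
  last condition.\<close>

definition extends_connection ::
  "('m::topological_space, 'n::{finite,linorder}) chart set \<Rightarrow> ('e \<Rightarrow> 'm)
     \<Rightarrow> ('m, 'e, 'r::finite) triv set
     \<Rightarrow> ('m set \<Rightarrow> ('m, 'n, 'e, 'r) vform \<Rightarrow> ('m, 'n, 'e, 'r) vform)
     \<Rightarrow> ('m set \<Rightarrow> ('m, 'n, 'e, 'r) vform \<Rightarrow> ('m, 'n, 'e, 'r) vform) \<Rightarrow> bool" where
  "extends_connection \<A> \<pi> \<T> D N \<longleftrightarrow> (\<forall>U k. open U \<longrightarrow>
     (\<forall>\<eta>\<in>vforms \<A> \<pi> \<T> U (ext_deg k). N U \<eta> \<in> vforms \<A> \<pi> \<T> U (ext_deg (k + 1))) \<and>
     (\<forall>\<eta>\<in>vforms \<A> \<pi> \<T> U (ext_deg k). \<forall>\<zeta>\<in>vforms \<A> \<pi> \<T> U (ext_deg k).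
        N U (\<eta> + \<zeta>) = N U \<eta> + N U \<zeta>) \<and>
     (\<forall>\<eta>\<in>vforms \<A> \<pi> \<T> U (ext_deg k). \<forall>W. open W \<and> W \<subseteq> U \<longrightarrow>
        N W (vrestrict W \<eta>) = vrestrict W (N U \<eta>)) \<and>
     (\<forall>\<tau>\<in>forms \<A> U (ext_deg k). \<forall>s\<in>vforms \<A> \<pi> \<T> U (ext_deg 0).
        N U (vwedge \<tau> s) =
          vwedge (ext_d \<A> U \<tau>) s + vwedge (\<lambda>c x. scl ((-1) ^ k) (\<tau> c x)) (D U s)))"

end

theory Submission
  imports Defs
begin

text \<open>The identity is pointwise and local.  Fix a chart \<open>c\<close> and a trivialization \<open>t\<close>.  Expanding \<open>\<eta>\<close> in the
frame \<open>e\<^sub>b\<close> of \<open>t\<close> turns the Leibniz rule into the formula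
\<open>(\<nabla>\<eta>)\<^sup>a = \<Sum>\<^sub>i gen i \<and> \<partial>\<^sub>i\<eta>\<^sup>a + \<Sum>\<^sub>b \<theta>\<^sub>b \<and> \<eta>\<^sup>b\<close>, in which \<open>i\<close> runs over both kinds of coordinate
vector fields and the 1-form \<open>\<theta>\<^sub>b\<close> is the \<open>a\<close>-th component of \<open>\<nabla>e\<^sub>b\<close> (\<open>nabla_local\<close>).  So \<open>\<nabla>\<close> is
assembled from left multiplications by 1-forms and coefficientwise derivatives.

Contraction \<open>i\<^sub>\<phi>\<close> with a \<open>(0,1)\<close>-form \<open>\<phi>\<close> with values in the holomorphic tangent bundle is a derivation
of degree 0 of the exterior algebra.  It kills \<open>(0,1)\<close>-forms, sends 1-forms to \<open>(0,1)\<close>-forms, and two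
such contractions commute.  Hence, for any 1-form \<open>\<theta>\<close>, where forms stand for left
multiplication by them in the composition of operators,
\<open>i\<^sub>\<phi> \<theta> i\<^sub>\<psi> - \<theta> i\<^sub>\<psi> i\<^sub>\<phi> + i\<^sub>\<psi> \<theta> i\<^sub>\<phi> - i\<^sub>\<psi> i\<^sub>\<phi> \<theta> = - (i\<^sub>\<psi> (i\<^sub>\<phi> \<theta>)) = 0\<close>
(\<open>contract_at_contract_at_one_form_wedge\<close>).  This removes the connection forms and all terms that contain a
derivative of \<open>\<eta>\<close>.  What remains is where the derivative hits \<open>\<phi>\<close> or \<open>\<psi>\<close>; there
\<open>\<Sum>\<^sub>a (i\<^sub>\<phi> gen a) \<and> (\<partial>\<^sub>a\<psi> \<lrcorner> \<eta>) + (i\<^sub>\<psi> gen a) \<and> (\<partial>\<^sub>a\<phi> \<lrcorner> \<eta>)\<close> reduces to the terms with \<open>a = Hol i\<close>, for which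
\<open>i\<^sub>\<phi> gen a = \<phi>\<^sup>i\<close>, and these are the contraction with the bracket (\<open>contract_at_bracket\<close>).

The remaining work shows that the connection may be applied to contractions: contractions of \<open>V\<close>-valued forms are
again smooth \<open>V\<close>-valued forms of the same degree (\<open>contract_vforms\<close>), which requires that pullback is an
algebra homomorphism compatible with interior products and that smooth functions form an algebra.\<close>

section \<open>The exterior algebra in its monomial basis\<close>

text \<open>Rewriting with the pointwise rules would also act on eta-expanded forms such as \<open>\<lambda>S. 0 S\<close> and turn \<open>0\<close>
into a \<open>\<lambda>\<close>-term to which the algebraic rules no longer apply.\<close>

lemmas fun_apply_simps = plus_fun_apply zero_fun_apply minus_apply uminus_apply
declare fun_apply_simps [simp del]

lemma ext_sum_apply: "(\<Sum>i\<in>I. f i) S = (\<Sum>i\<in>I. f i S)" for f :: "'i \<Rightarrow> 's \<Rightarrow> complex"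
  by (induction I rule: infinite_finite_induct) (auto simp: fun_apply_simps)

definition mon :: "'n cidx set \<Rightarrow> 'n ext" where
  "mon S = (\<lambda>T. if T = S then 1 else 0)"

lemma gen_eq_mon: "gen a = mon {a}"
  by (simp add: gen_def mon_def)

lemma scalar_eq_mon: "scalar 1 = mon {}"
  by (simp add: scalar_def mon_def)

lemma scalar_eq_scl: "scalar c = scl c (mon {})"
  by (auto simp: scalar_def mon_def scl_def)

lemma ext_expand: "(\<omega> :: 'n::{finite,linorder} ext) = (\<Sum>S\<in>UNIV. scl (\<omega> S) (mon S))"
  by (rule ext) (simp add: ext_sum_apply scl_def mon_def if_distrib cong: if_cong)

lemma scl_simps [simp]:
  "scl 0 \<omega> = 0" "scl 1 \<omega> = \<omega>" "scl c 0 = 0" "scl c (scl d \<omega>) = scl (c * d) \<omega>"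
  by (auto simp: scl_def fun_apply_simps)

lemma scl_minus_one: "scl (-1) \<omega> = - \<omega>"
  by (auto simp: scl_def fun_apply_simps)

lemma scl_uminus: "scl (- c) \<omega> = - scl c \<omega>"
  by (auto simp: scl_def fun_apply_simps)

lemma scl_diff: "scl c (\<alpha> - \<beta>) = scl c \<alpha> - scl c \<beta>"
  by (auto simp: scl_def fun_apply_simps algebra_simps)

lemma scl_distrib: "scl c (\<alpha> + \<beta>) = scl c \<alpha> + scl c \<beta>" "scl c (- \<alpha>) = - scl c \<alpha>"
  by (auto simp: scl_def fun_apply_simps algebra_simps)

text \<open>A linear map is determined by its values on the monomial basis, which reduces
multilinear identities to computations with signs (\<open>lin_eqI\<close> below).\<close>

definition ext_linear :: "('n ext \<Rightarrow> 'n ext) \<Rightarrow> bool" where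
  "ext_linear F \<longleftrightarrow> (\<forall>\<alpha> \<beta>. F (\<alpha> + \<beta>) = F \<alpha> + F \<beta>) \<and> (\<forall>c \<alpha>. F (scl c \<alpha>) = scl c (F \<alpha>))"

lemma ext_linearI:
  assumes "\<And>\<alpha> \<beta>. F (\<alpha> + \<beta>) = F \<alpha> + F \<beta>" "\<And>c \<alpha>. F (scl c \<alpha>) = scl c (F \<alpha>)"
  shows "ext_linear F"
  using assms by (simp add: ext_linear_def)

context
  fixes F :: "'n::{finite,linorder} ext \<Rightarrow> 'n ext"
  assumes F: "ext_linear F"
begin

lemma lin_add: "F (\<alpha> + \<beta>) = F \<alpha> + F \<beta>"
  and lin_scl: "F (scl c \<alpha>) = scl c (F \<alpha>)"
  using F by (auto simp: ext_linear_def)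

lemma lin_0: "F 0 = 0"
  using lin_scl[of 0 0] by simp

lemma lin_minus: "F (- \<alpha>) = - F \<alpha>"
  using lin_scl[of "-1" \<alpha>] by (simp add: scl_minus_one)

lemma lin_diff: "F (\<alpha> - \<beta>) = F \<alpha> - F \<beta>"
  using lin_add[of \<alpha> "- \<beta>"] by (simp add: lin_minus)

lemma lin_sum: "F (\<Sum>i\<in>I. f i) = (\<Sum>i\<in>I. F (f i))"
  using sum_comp_morphism[of F f I] by (simp add: lin_0 lin_add o_def)

lemma lin_expand: "F \<omega> = (\<Sum>S\<in>UNIV. scl (\<omega> S) (F (mon S)))"
proof -
  have "F \<omega> = F (\<Sum>S\<in>UNIV. scl (\<omega> S) (mon S))" using ext_expand[of \<omega>] by simp
  then show ?thesis by (simp add: lin_sum lin_scl)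
qed

end

lemma lin_eqI:
  assumes "ext_linear F" "ext_linear G" "\<And>S. F (mon S) = G (mon S)"
  shows "F \<omega> = G (\<omega> :: 'n::{finite,linorder} ext)"
  by (subst lin_expand[OF assms(1)], subst lin_expand[OF assms(2)]) (simp add: assms(3))

lemma scl_sum: "scl c (\<Sum>i\<in>I. f i) = (\<Sum>i\<in>I. scl c (f i))" for f :: "'i \<Rightarrow> 'n::{finite,linorder} ext"
  by (rule lin_sum) (simp add: ext_linear_def scl_distrib mult.commute)

lemma lin_wedge_right: "ext_linear (\<lambda>\<beta>. \<alpha> \<and>\<^sub>w \<beta>)"
  by (rule ext_linearI) (auto simp: wedge_def scl_def fun_apply_simps sum.distrib sum_distrib_left algebra_simps intro!: ext)

lemma lin_wedge_left: "ext_linear (\<lambda>\<alpha>. \<alpha> \<and>\<^sub>w \<beta>)"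
  by (rule ext_linearI) (auto simp: wedge_def scl_def fun_apply_simps sum.distrib sum_distrib_left algebra_simps intro!: ext)

lemma lin_iprod: "ext_linear (iprod a)"
  by (rule ext_linearI) (auto simp: iprod_def scl_def fun_apply_simps algebra_simps intro!: ext)

lemma lin_subst_gen: "ext_linear (subst_gen f)"
  by (rule ext_linearI)
    (auto simp: subst_gen_def scl_def fun_apply_simps sum.distrib sum_distrib_left ext_sum_apply algebra_simps intro!: ext)

lemmas wedge_add_left = lin_add[OF lin_wedge_left]
lemmas wedge_add_right = lin_add[OF lin_wedge_right]
lemmas wedge_scl_left = lin_scl[OF lin_wedge_left]
lemmas wedge_scl_right = lin_scl[OF lin_wedge_right]
lemmas wedge_sum_left = lin_sum[OF lin_wedge_left]
lemmas wedge_sum_right = lin_sum[OF lin_wedge_right]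
lemmas wedge_minus_left = lin_minus[OF lin_wedge_left]
lemmas wedge_minus_right = lin_minus[OF lin_wedge_right]
lemmas wedge_zero_left [simp] = lin_0[OF lin_wedge_left]
lemmas wedge_zero_right [simp] = lin_0[OF lin_wedge_right]
lemmas iprod_add = lin_add[OF lin_iprod]
lemmas iprod_scl = lin_scl[OF lin_iprod]
lemmas subst_gen_add = lin_add[OF lin_subst_gen]
lemmas subst_gen_scl = lin_scl[OF lin_subst_gen]
lemmas ext_linear_simps = ext_linear_def wedge_add_left wedge_add_right wedge_scl_left wedge_scl_right
  iprod_add iprod_scl subst_gen_add subst_gen_scl scl_distrib
lemmas iprod_zero [simp] = lin_0[OF lin_iprod]

lemma sign_square: "shuffle_sign A B * shuffle_sign A B = 1"
  by (simp add: shuffle_sign_def flip: power_mult_distrib)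

lemma sign_cases: "shuffle_sign A B = 1 \<or> shuffle_sign A B = -1"
  unfolding shuffle_sign_def by (cases "even (card {(a, b). a \<in> A \<and> b \<in> B \<and> b < a})") auto

lemma sign_Un_left:
  assumes "A \<inter> B = {}"
  shows "shuffle_sign (A \<union> B) C = shuffle_sign A C * shuffle_sign B C"
proof -
  let ?I = "\<lambda>A. {(a, b). a \<in> A \<and> b \<in> C \<and> b < a}"
  have "card (?I (A \<union> B)) = card (?I A \<union> ?I B)" by (rule arg_cong[of _ _ card]) auto
  also have "\<dots> = card (?I A) + card (?I B)"
    using assms by (intro card_Un_disjoint) auto
  finally show ?thesis by (simp add: shuffle_sign_def power_add)
qed

lemma sign_Un_right:
  assumes "B \<inter> C = {}"
  shows "shuffle_sign A (B \<union> C) = shuffle_sign A B * shuffle_sign A C"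
proof -
  let ?I = "\<lambda>B. {(a, b). a \<in> A \<and> b \<in> B \<and> b < a}"
  have "card (?I (B \<union> C)) = card (?I B \<union> ?I C)" by (rule arg_cong[of _ _ card]) auto
  also have "\<dots> = card (?I B) + card (?I C)"
    using assms by (intro card_Un_disjoint) auto
  finally show ?thesis by (simp add: shuffle_sign_def power_add)
qed

lemma sign_empty [simp]: "shuffle_sign {} A = 1" "shuffle_sign A {} = 1"
  by (simp_all add: shuffle_sign_def)

text \<open>Of the two orders of a pair \<open>(a, b)\<close> from \<open>A \<times> B\<close>, exactly one is an inversion.\<close>

lemma sign_swap:
  assumes "A \<inter> B = {}"
  shows "shuffle_sign A B * shuffle_sign B A = (-1) ^ (card A * card B)"
proof -
  let ?I = "{(a, b). a \<in> A \<and> b \<in> B \<and> b < a}" and ?J = "{(b, a). b \<in> B \<and> a \<in> A \<and> a < b}"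
  have "card A * card B = card (?I \<union> prod.swap ` ?J)"
    unfolding card_cartesian_product[symmetric]
    by (rule arg_cong[of _ _ card]) (use assms in \<open>auto simp: image_iff disjoint_iff not_less_iff_gr_or_eq\<close>)
  also have "\<dots> = card ?I + card ?J"
    by (subst card_Un_disjoint) (auto simp: card_image)
  finally show ?thesis by (simp add: shuffle_sign_def power_add)
qed

lemma sign_below: "(\<And>b. b \<in> B \<Longrightarrow> a < b) \<Longrightarrow> shuffle_sign {a} B = 1"
  unfolding shuffle_sign_def
  by (subgoal_tac "{(x, b). x \<in> {a} \<and> b \<in> B \<and> b < x} = {}", simp only: card.empty power_0)
    (auto dest: order.asym)

lemma mon_wedge: "mon A \<and>\<^sub>w mon B = (if A \<inter> B = {} then scl (shuffle_sign A B) (mon (A \<union> B)) else 0)"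
proof (rule ext)
  fix S :: "'a cidx set"
  have "(mon A \<and>\<^sub>w mon B) S = (\<Sum>X\<in>Pow S. if X = A then (if S - A = B then shuffle_sign A B else 0) else 0)"
    unfolding wedge_def by (rule sum.cong) (auto simp: mon_def)
  also have "\<dots> = (if A \<subseteq> S \<and> S - A = B then shuffle_sign A B else 0)"
    by (subst sum.delta) auto
  also have "\<dots> = (if A \<inter> B = {} then scl (shuffle_sign A B) (mon (A \<union> B)) else 0) S"
    by (auto simp: scl_def mon_def fun_apply_simps)
  finally show "(mon A \<and>\<^sub>w mon B) S = \<dots>" .
qed

text \<open>On monomials both sides are the same monomial with a product of three signs, because inversions are
counted additively; if two of the index sets meet, both sides vanish.\<close>

lemma wedge_assoc: "(\<alpha> \<and>\<^sub>w \<beta>) \<and>\<^sub>w \<gamma> = \<alpha> \<and>\<^sub>w (\<beta> \<and>\<^sub>w \<gamma>)"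
proof -
  have m: "(mon A \<and>\<^sub>w mon B) \<and>\<^sub>w mon C = mon A \<and>\<^sub>w (mon B \<and>\<^sub>w (mon C :: 'a ext))" for A B C
  proof (cases "A \<inter> B = {} \<and> A \<inter> C = {} \<and> B \<inter> C = {}")
    case True
    then have "(A \<union> B) \<inter> C = {}" "A \<inter> (B \<union> C) = {}" by auto
    with True show ?thesis
      by (simp add: mon_wedge wedge_scl_left wedge_scl_right sign_Un_left sign_Un_right mult_ac Un_assoc)
  next
    case False
    then consider "A \<inter> B \<noteq> {}" | "B \<inter> C \<noteq> {}" | "A \<inter> B = {}" "B \<inter> C = {}" "A \<inter> C \<noteq> {}" by blast
    then show ?thesis
    proof cases
      case 3
      then have "(A \<union> B) \<inter> C \<noteq> {}" "A \<inter> (B \<union> C) \<noteq> {}" by auto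
      then show ?thesis by (simp add: mon_wedge wedge_scl_left wedge_scl_right)
    next
      case 1
      then have "A \<inter> (B \<union> C) \<noteq> {}" by auto
      with 1 show ?thesis by (simp add: mon_wedge wedge_scl_left wedge_scl_right)
    next
      case 2
      then have "(A \<union> B) \<inter> C \<noteq> {}" by auto
      with 2 show ?thesis by (simp add: mon_wedge wedge_scl_left wedge_scl_right)
    qed
  qed
  have m2: "(mon A \<and>\<^sub>w mon B) \<and>\<^sub>w \<gamma> = mon A \<and>\<^sub>w (mon B \<and>\<^sub>w \<gamma>)" for A B
    by (rule lin_eqI[where F = "\<lambda>\<gamma>. (mon A \<and>\<^sub>w mon B) \<and>\<^sub>w \<gamma>" and G = "\<lambda>\<gamma>. mon A \<and>\<^sub>w (mon B \<and>\<^sub>w \<gamma>)"])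
      (simp_all only: ext_linear_simps m simp_thms)
  have m3: "(mon A \<and>\<^sub>w \<beta>) \<and>\<^sub>w \<gamma> = mon A \<and>\<^sub>w (\<beta> \<and>\<^sub>w \<gamma>)" for A
    by (rule lin_eqI[where F = "\<lambda>\<beta>. (mon A \<and>\<^sub>w \<beta>) \<and>\<^sub>w \<gamma>" and G = "\<lambda>\<beta>. mon A \<and>\<^sub>w (\<beta> \<and>\<^sub>w \<gamma>)"])
      (simp_all only: ext_linear_simps m2 simp_thms)
  show ?thesis
    by (rule lin_eqI[where F = "\<lambda>\<alpha>. (\<alpha> \<and>\<^sub>w \<beta>) \<and>\<^sub>w \<gamma>" and G = "\<lambda>\<alpha>. \<alpha> \<and>\<^sub>w (\<beta> \<and>\<^sub>w \<gamma>)"])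
      (simp_all only: ext_linear_simps m3 simp_thms)
qed

lemma scalar_wedge [simp]: "scalar c \<and>\<^sub>w \<omega> = scl c \<omega>" "\<omega> \<and>\<^sub>w scalar c = scl c \<omega>"
proof -
  have "scalar 1 \<and>\<^sub>w \<omega> = \<omega>"
    by (rule lin_eqI[where F = "\<lambda>\<omega>. scalar 1 \<and>\<^sub>w \<omega>" and G = "\<lambda>\<omega>. \<omega>"])
      (auto simp: ext_linear_simps scalar_eq_mon mon_wedge)
  then show "scalar c \<and>\<^sub>w \<omega> = scl c \<omega>" by (simp add: scalar_eq_scl wedge_scl_left)
  have "\<omega> \<and>\<^sub>w scalar 1 = \<omega>"
    by (rule lin_eqI[where F = "\<lambda>\<omega>. \<omega> \<and>\<^sub>w scalar 1" and G = "\<lambda>\<omega>. \<omega>"])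
      (auto simp: ext_linear_simps scalar_eq_mon mon_wedge)
  then show "\<omega> \<and>\<^sub>w scalar c = scl c \<omega>" by (simp add: scalar_eq_scl wedge_scl_right)
qed

lemma gen_wedge_mon: "gen a \<and>\<^sub>w mon S = (if a \<in> S then 0 else scl (shuffle_sign {a} S) (mon (insert a S)))"
  by (simp add: gen_eq_mon mon_wedge)

lemma mon_insert_min: "(\<And>b. b \<in> S \<Longrightarrow> a < b) \<Longrightarrow> mon (insert a S) = gen a \<and>\<^sub>w mon S"
  by (auto simp: gen_wedge_mon sign_below)

section \<open>Induction on generators and forms of degree one\<close>

text \<open>The exterior algebra is generated by the 1-forms \<open>gen a\<close>: a basis element is the product of its smallest
generator and the basis element of the remaining ones, with no sign.  Identities between antiderivations
and homomorphisms are proved with this rule, without evaluating signs of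
shuffles.\<close>

lemma ext_induct [case_names one add scl gen]:
  fixes \<omega> :: "'n::{finite,linorder} ext"
  assumes "P (scalar 1)" and add: "\<And>\<alpha> \<beta>. P \<alpha> \<Longrightarrow> P \<beta> \<Longrightarrow> P (\<alpha> + \<beta>)" and scl: "\<And>c \<alpha>. P \<alpha> \<Longrightarrow> P (scl c \<alpha>)"
    and "\<And>a \<alpha>. P \<alpha> \<Longrightarrow> P (gen a \<and>\<^sub>w \<alpha>)"
  shows "P \<omega>"
proof -
  have m: "P (mon S)" for S :: "'n cidx set"
    using finite[of S]
  proof (induction S rule: finite_linorder_min_induct)
    case empty
    show ?case using assms(1) by (simp add: scalar_eq_mon)
  next
    case (insert a S)
    then show ?case using assms(4)[of "mon S" a] mon_insert_min[of S a] by simp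
  qed
  have "P (\<Sum>S\<in>A. scl (\<omega> S) (mon S))" for A
  proof (induction A rule: infinite_finite_induct)
    case (insert x F)
    have "(\<Sum>S\<in>insert x F. scl (\<omega> S) (mon S)) = scl (\<omega> x) (mon x) + (\<Sum>S\<in>F. scl (\<omega> S) (mon S))"
      by (rule sum.insert[OF insert.hyps])
    then show ?case using add[OF scl[OF m] insert.IH, of "\<omega> x" x] by (simp only:)
  next
    case (infinite A)
    have "(\<Sum>S\<in>A. scl (\<omega> S) (mon S)) = scl 0 (mon {})"
      using infinite by simp
    with scl[OF m] show ?case by (simp only:)
  next
    case empty
    have "(\<Sum>S\<in>{}. scl (\<omega> S) (mon S)) = scl 0 (mon {})"
      by simp
    with scl[OF m] show ?case by (simp only:)
  qed
  then show ?thesis by (subst ext_expand[of \<omega>])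
qed

lemma gen_anticomm: "gen a \<and>\<^sub>w gen b = - (gen b \<and>\<^sub>w gen a)"
proof (cases "a = b")
  case True
  then show ?thesis by (simp add: gen_eq_mon mon_wedge)
next
  case False
  then have "shuffle_sign {a} {b} * shuffle_sign {b} {a} = -1" by (subst sign_swap) auto
  then have "shuffle_sign {a} {b} = - shuffle_sign {b} {a}"
    using sign_cases[of "{a}" "{b}"] sign_cases[of "{b}" "{a}"] by auto
  with False show ?thesis by (simp add: gen_eq_mon mon_wedge insert_commute scl_def fun_eq_iff fun_apply_simps)
qed

lemma one_form_expand:
  fixes \<alpha> :: "'n::{finite,linorder} ext"
  assumes "\<alpha> \<in> ext_deg 1"
  shows "\<alpha> = (\<Sum>a\<in>UNIV. scl (\<alpha> {a}) (gen a))"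
proof (rule ext)
  fix S
  show "\<alpha> S = (\<Sum>a\<in>UNIV. scl (\<alpha> {a}) (gen a)) S"
  proof (cases "\<exists>b. S = {b}")
    case True
    then obtain b where "S = {b}" by blast
    then show ?thesis by (simp add: ext_sum_apply scl_def gen_def if_distrib cong: if_cong)
  next
    case False
    then have "card S \<noteq> 1" by (metis card_1_singletonE)
    with assms have "\<alpha> S = 0" by (auto simp: ext_deg_def)
    with False show ?thesis by (auto simp: ext_sum_apply scl_def gen_def)
  qed
qed

lemma one_form_lin_eqI:
  assumes "\<alpha> \<in> ext_deg 1" "ext_linear F" "ext_linear G" "\<And>a. F (gen a) = G (gen a)"
  shows "F \<alpha> = G (\<alpha> :: 'n::{finite,linorder} ext)"
proof -
  have "F (\<Sum>a\<in>UNIV. scl (\<alpha> {a}) (gen a)) = G (\<Sum>a\<in>UNIV. scl (\<alpha> {a}) (gen a))"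
    using assms by (simp add: lin_sum lin_scl)
  with one_form_expand[OF assms(1)] show ?thesis by simp
qed

lemma gen_wedge_graded_comm:
  assumes "\<omega> \<in> ext_deg k"
  shows "gen a \<and>\<^sub>w \<omega> = scl ((-1) ^ k) (\<omega> \<and>\<^sub>w gen a)"
proof -
  have m: "gen a \<and>\<^sub>w mon S = scl ((-1) ^ k) (mon S \<and>\<^sub>w gen a)" if "card S = k" for S :: "'a cidx set"
  proof (cases "a \<in> S")
    case False
    then have "shuffle_sign {a} S * shuffle_sign S {a} = (-1) ^ k" using that by (subst sign_swap) auto
    then have "shuffle_sign {a} S = (-1) ^ k * shuffle_sign S {a}"
      by (metis mult.assoc mult.right_neutral sign_square)
    with False show ?thesis by (simp add: gen_eq_mon mon_wedge)
  qed (simp add: gen_eq_mon mon_wedge)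
  have "scl (\<omega> S) (gen a \<and>\<^sub>w mon S) = scl (\<omega> S) (scl ((-1) ^ k) (mon S \<and>\<^sub>w gen a))" for S
    using m[of S] assms by (cases "\<omega> S = 0") (auto simp: ext_deg_def)
  moreover have "gen a \<and>\<^sub>w \<omega> = (\<Sum>S\<in>UNIV. scl (\<omega> S) (gen a \<and>\<^sub>w mon S))"
    by (rule lin_expand[OF lin_wedge_right])
  moreover have "scl ((-1) ^ k) (\<omega> \<and>\<^sub>w gen a) = (\<Sum>S\<in>UNIV. scl (\<omega> S) (scl ((-1) ^ k) (mon S \<and>\<^sub>w gen a)))"
    by (rule lin_expand[where F = "\<lambda>\<omega>. scl ((-1) ^ k) (\<omega> \<and>\<^sub>w gen a)"]) (simp add: ext_linear_simps mult.commute)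
  ultimately show ?thesis by simp
qed

lemma one_form_graded_comm:
  assumes "\<theta> \<in> ext_deg 1" "\<omega> \<in> ext_deg k"
  shows "\<theta> \<and>\<^sub>w \<omega> = scl ((-1) ^ k) (\<omega> \<and>\<^sub>w \<theta>)"
  by (rule one_form_lin_eqI[OF assms(1), where F = "\<lambda>\<theta>. \<theta> \<and>\<^sub>w \<omega>" and G = "\<lambda>\<theta>. scl ((-1) ^ k) (\<omega> \<and>\<^sub>w \<theta>)"])
    (auto simp: ext_linear_simps gen_wedge_graded_comm[OF assms(2)] mult.commute)

lemma one_form_anticomm:
  assumes "\<alpha> \<in> ext_deg 1" "\<beta> \<in> ext_deg 1"
  shows "\<alpha> \<and>\<^sub>w \<beta> = - (\<beta> \<and>\<^sub>w \<alpha>)"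
  using one_form_graded_comm[OF assms] by (simp add: scl_minus_one)

section \<open>The interior product\<close>

lemma iprod_mon: "iprod a (mon S) = (if a \<in> S then scl (shuffle_sign {a} (S - {a})) (mon (S - {a})) else 0)"
  by (rule ext) (auto simp: iprod_def mon_def scl_def fun_apply_simps)

text \<open>The antiderivation property for a generator.  The case \<open>a \<noteq> b\<close> is where signs enter: removing \<open>a\<close> after
inserting \<open>b\<close> and inserting \<open>b\<close> after removing \<open>a\<close> differ by the transposition of \<open>a\<close> and \<open>b\<close>.\<close>

lemma iprod_gen_wedge:
  "iprod a (gen b \<and>\<^sub>w \<omega>) = (if a = b then \<omega> else 0) - gen b \<and>\<^sub>w iprod a \<omega>"
proof -
  have m: "iprod a (gen b \<and>\<^sub>w mon S) = (if a = b then mon S else 0) - gen b \<and>\<^sub>w iprod a (mon S)" for S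
  proof (cases "a = b")
    case True
    then show ?thesis
      by (auto simp: gen_wedge_mon iprod_mon lin_scl[OF lin_iprod] wedge_scl_right sign_square insert_absorb)
  next
    case ne: False
    show ?thesis
    proof (cases "a \<in> S \<and> b \<notin> S")
      case False
      with ne show ?thesis
        by (auto simp: gen_wedge_mon iprod_mon lin_scl[OF lin_iprod] wedge_scl_right)
    next
      case True
      define R where "R = S - {a}"
      have S: "S = insert a R" "a \<notin> R" "b \<notin> R" using True by (auto simp: R_def)
      have ins: "insert b S - {a} = insert b R" using S ne by auto
      have 1: "shuffle_sign {b} S = shuffle_sign {b} {a} * shuffle_sign {b} R"
        using sign_Un_right[of "{a}" R "{b}"] S by simp
      have 2: "shuffle_sign {a} (insert b R) = shuffle_sign {a} {b} * shuffle_sign {a} R"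
        using sign_Un_right[of "{b}" R "{a}"] S by simp
      have 3: "shuffle_sign {a} {b} * shuffle_sign {b} {a} = -1"
        using ne by (subst sign_swap) auto
      have "shuffle_sign {b} S * shuffle_sign {a} (insert b R) =
          (shuffle_sign {a} {b} * shuffle_sign {b} {a}) * (shuffle_sign {a} R * shuffle_sign {b} R)"
        unfolding 1 2 by (simp add: mult_ac)
      also have "\<dots> = - (shuffle_sign {a} R * shuffle_sign {b} R)" unfolding 3 by simp
      finally have s: "shuffle_sign {b} S * shuffle_sign {a} (insert b R) = \<dots>" .
      have "iprod a (gen b \<and>\<^sub>w mon S) = scl (shuffle_sign {b} S * shuffle_sign {a} (insert b R)) (mon (insert b R))"
        using True ne by (simp add: gen_wedge_mon iprod_mon lin_scl[OF lin_iprod] ins)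
      also have "\<dots> = - (gen b \<and>\<^sub>w iprod a (mon S))"
        unfolding s using True S by (simp add: gen_wedge_mon iprod_mon wedge_scl_right scl_uminus flip: R_def)
      finally show ?thesis using ne by simp
    qed
  qed
  show ?thesis
    by (rule lin_eqI[where F = "\<lambda>\<omega>. iprod a (gen b \<and>\<^sub>w \<omega>)" and
          G = "\<lambda>\<omega>. (if a = b then \<omega> else 0) - gen b \<and>\<^sub>w iprod a \<omega>"])
      (auto simp: ext_linear_simps m scl_diff)
qed

lemma iprod_one_form_wedge:
  assumes "\<alpha> \<in> ext_deg 1"
  shows "iprod a (\<alpha> \<and>\<^sub>w \<omega>) = scl (\<alpha> {a}) \<omega> - \<alpha> \<and>\<^sub>w iprod a \<omega>"
proof (rule one_form_lin_eqI[OF assms, where F = "\<lambda>\<alpha>. iprod a (\<alpha> \<and>\<^sub>w \<omega>)"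
      and G = "\<lambda>\<alpha>. scl (\<alpha> {a}) \<omega> - \<alpha> \<and>\<^sub>w iprod a \<omega>"])
  show "iprod a (gen b \<and>\<^sub>w \<omega>) = scl (gen b {a}) \<omega> - gen b \<and>\<^sub>w iprod a \<omega>" for b
    unfolding iprod_gen_wedge by (auto simp: gen_def[of b, THEN fun_cong])
qed (auto simp: ext_linear_simps scl_diff, auto simp: scl_def fun_eq_iff fun_apply_simps algebra_simps)

lemma iprod_one [simp]: "iprod a (scalar c) = 0"
  by (rule ext) (simp add: iprod_def scalar_def fun_apply_simps)

lemma iprod_anticomm: "iprod a (iprod b \<omega>) = - iprod b (iprod a \<omega>)"
proof (induction \<omega> rule: ext_induct)
  case (gen c \<alpha>)
  then show ?case
    by (auto simp: iprod_gen_wedge lin_diff[OF lin_iprod] wedge_minus_right)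
qed (simp_all add: lin_add[OF lin_iprod] lin_scl[OF lin_iprod] scl_distrib)

section \<open>Substitution of generators and pullback\<close>

lemma subst_gen_mon: "subst_gen f (mon S) = foldr (\<and>\<^sub>w) (map f (sorted_list_of_set S)) (scalar 1)"
proof -
  have "subst_gen f (mon S) =
    (\<Sum>T\<in>UNIV. if T = S then foldr (\<and>\<^sub>w) (map f (sorted_list_of_set T)) (scalar 1) else 0)"
    unfolding subst_gen_def by (rule sum.cong) (auto simp: mon_def)
  then show ?thesis by simp
qed

lemma subst_gen_scalar: "subst_gen f (scalar c) = scalar c"
  by (simp add: scalar_eq_scl lin_scl[OF lin_subst_gen] subst_gen_mon scalar_eq_mon)

lemma subst_gen_mon_min:
  assumes "\<And>b. b \<in> S \<Longrightarrow> a < b"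
  shows "subst_gen f (mon (insert a S)) = f a \<and>\<^sub>w subst_gen f (mon S)"
proof -
  have "sorted_list_of_set (insert a S) = a # sorted_list_of_set S"
    using assms by (subst sorted_list_of_set_insert) (auto intro!: insort_is_Cons order.strict_implies_order)
  then show ?thesis by (simp add: subst_gen_mon)
qed

text \<open>The hypothesis is the defining relation of the exterior algebra; it also forces \<open>f a \<and> f a = 0\<close>.
The proof moves \<open>gen a\<close> past the smaller generators of a monomial one at a time,
so that no sign has to be evaluated.\<close>

lemma subst_gen_wedge_gen:
  fixes f :: "'n::{finite,linorder} cidx \<Rightarrow> 'n ext"
  assumes f: "\<And>a b. f a \<and>\<^sub>w f b = - (f b \<and>\<^sub>w f a)"
  shows "subst_gen f (gen a \<and>\<^sub>w \<omega>) = f a \<and>\<^sub>w subst_gen f \<omega>"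
proof -
  have sq: "f a \<and>\<^sub>w f a = 0" for a
    using f[of a a] by (auto simp: fun_eq_iff fun_apply_simps)
  have m: "subst_gen f (gen a \<and>\<^sub>w mon S) = f a \<and>\<^sub>w subst_gen f (mon S)" for S :: "'n cidx set"
    using finite[of S]
  proof (induction S arbitrary: a rule: finite_linorder_min_induct)
    case (empty a)
    show ?case using subst_gen_mon_min[of "{}" a f] by (simp add: gen_wedge_mon)
  next
    case (insert m S a)
    have mS: "m < b" if "b \<in> S" for b using insert(2) that by blast
    consider "a < m" | "a = m" | "m < a" by fastforce
    then show ?case
    proof cases
      case 1
      then have "a < b" if "b \<in> insert m S" for b using mS that by force
      then show ?thesis using mon_insert_min[of "insert m S" a] subst_gen_mon_min[of "insert m S" a f] by simp
    next
      case 2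
      have "f m \<and>\<^sub>w f m \<and>\<^sub>w subst_gen f (mon S) = 0" by (simp add: sq flip: wedge_assoc)
      then show ?thesis using mS 2
        by (simp add: gen_wedge_mon subst_gen_mon_min lin_0[OF lin_subst_gen])
    next
      case 3
      have swap: "subst_gen f (gen m \<and>\<^sub>w gen a \<and>\<^sub>w mon S) = f m \<and>\<^sub>w subst_gen f (gen a \<and>\<^sub>w mon S)"
      proof (cases "a \<in> S")
        case True
        then show ?thesis by (simp add: gen_wedge_mon lin_0[OF lin_subst_gen])
      next
        case False
        have *: "m < b" if "b \<in> insert a S" for b using mS that 3 by blast
        have 1: "gen m \<and>\<^sub>w mon (insert a S) = mon (insert m (insert a S))"
          by (rule mon_insert_min[symmetric]) (rule *)
        have 2: "subst_gen f (mon (insert m (insert a S))) = f m \<and>\<^sub>w subst_gen f (mon (insert a S))"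
          by (rule subst_gen_mon_min) (rule *)
        show ?thesis using False
          by (simp only: gen_wedge_mon[of a] if_False wedge_scl_right subst_gen_scl 1 2)
      qed
      have "gen a \<and>\<^sub>w mon (insert m S) = (gen a \<and>\<^sub>w gen m) \<and>\<^sub>w mon S"
        using mon_insert_min[OF mS] by (simp add: wedge_assoc)
      also have "\<dots> = - (gen m \<and>\<^sub>w gen a \<and>\<^sub>w mon S)"
        by (simp add: gen_anticomm[of a m] wedge_minus_left wedge_assoc)
      finally have "subst_gen f (gen a \<and>\<^sub>w mon (insert m S)) = - (f m \<and>\<^sub>w f a \<and>\<^sub>w subst_gen f (mon S))"
        using swap insert(3)[of a] by (simp add: lin_minus[OF lin_subst_gen])
      also have "\<dots> = (- (f m \<and>\<^sub>w f a)) \<and>\<^sub>w subst_gen f (mon S)"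
        by (simp add: wedge_minus_left wedge_assoc)
      also have "\<dots> = f a \<and>\<^sub>w f m \<and>\<^sub>w subst_gen f (mon S)"
        by (simp add: f[of a m, symmetric] wedge_assoc)
      finally show ?thesis by (simp add: subst_gen_mon_min[OF mS])
    qed
  qed
  show ?thesis
    by (rule lin_eqI[where F = "\<lambda>\<omega>. subst_gen f (gen a \<and>\<^sub>w \<omega>)" and G = "\<lambda>\<omega>. f a \<and>\<^sub>w subst_gen f \<omega>"])
      (auto simp: ext_linear_simps m)
qed

lemma subst_gen_wedge:
  fixes f :: "'n::{finite,linorder} cidx \<Rightarrow> 'n ext"
  assumes f: "\<And>a b. f a \<and>\<^sub>w f b = - (f b \<and>\<^sub>w f a)"
  shows "subst_gen f (\<alpha> \<and>\<^sub>w \<beta>) = subst_gen f \<alpha> \<and>\<^sub>w subst_gen f \<beta>"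
proof (induction \<alpha> rule: ext_induct)
  case (gen a \<alpha>)
  have g: "subst_gen f (gen a \<and>\<^sub>w \<omega>) = f a \<and>\<^sub>w subst_gen f \<omega>" for \<omega>
    by (rule subst_gen_wedge_gen) (rule f)
  have "subst_gen f ((gen a \<and>\<^sub>w \<alpha>) \<and>\<^sub>w \<beta>) = f a \<and>\<^sub>w subst_gen f (\<alpha> \<and>\<^sub>w \<beta>)"
    unfolding wedge_assoc by (rule g)
  then show ?case
    unfolding gen g wedge_assoc .
next
  case one
  show ?case by (simp only: subst_gen_scalar scalar_wedge scl_simps)
next
  case (add \<alpha> \<alpha>')
  show ?case by (simp only: wedge_add_left subst_gen_add add)
next
  case (scl c \<alpha>)
  show ?case by (simp only: wedge_scl_left subst_gen_scl scl)
qed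

text \<open>The images of the generators in the definition of \<open>pull\<close>.\<close>

definition pull_gen :: "complex ^ 'n::{finite,linorder} ^ 'n::{finite,linorder} \<Rightarrow> 'n cidx \<Rightarrow> 'n ext" where
  "pull_gen J a = (case a of
      Hol i \<Rightarrow> (\<Sum>j\<in>UNIV. scl (J $ i $ j) (gen (Hol j)))
    | Anti i \<Rightarrow> (\<Sum>j\<in>UNIV. scl (cnj (J $ i $ j)) (gen (Anti j))))"

lemma pull_eq: "pull J = subst_gen (pull_gen J)"
  by (simp add: pull_def pull_gen_def[abs_def])

lemma ext_deg_closed [intro]:
  "0 \<in> ext_deg k" "\<alpha> \<in> ext_deg k \<Longrightarrow> \<beta> \<in> ext_deg k \<Longrightarrow> \<alpha> + \<beta> \<in> ext_deg k"
  "\<alpha> \<in> ext_deg k \<Longrightarrow> scl c \<alpha> \<in> ext_deg k"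
  by (auto simp: ext_deg_def scl_def fun_apply_simps) (metis add.right_neutral)+

lemma ext_deg_sum [intro]: "(\<And>i. i \<in> I \<Longrightarrow> f i \<in> ext_deg k) \<Longrightarrow> (\<Sum>i\<in>I. f i) \<in> ext_deg k"
  by (induction I rule: infinite_finite_induct) auto

lemma gen_deg [intro]: "gen a \<in> ext_deg 1"
  by (auto simp: gen_def ext_deg_def)

lemma pull_gen_deg: "pull_gen J a \<in> ext_deg 1"
  by (cases a) (auto simp: pull_gen_def simp del: One_nat_def)

lemma pull_gen_Hol: "pull_gen J a {Hol j} = (case a of Hol i \<Rightarrow> J $ i $ j | Anti i \<Rightarrow> 0)"
  by (cases a) (auto simp: pull_gen_def ext_sum_apply scl_def gen_def if_distrib cong: if_cong)

lemmas lin_pull = lin_subst_gen[of "pull_gen J" for J, folded pull_eq]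

lemma pull_wedge: "pull J (\<alpha> \<and>\<^sub>w \<beta>) = pull J \<alpha> \<and>\<^sub>w pull J \<beta>"
  unfolding pull_eq by (intro subst_gen_wedge one_form_anticomm pull_gen_deg)

lemma pull_gen_wedge: "pull J (gen a \<and>\<^sub>w \<beta>) = pull_gen J a \<and>\<^sub>w pull J \<beta>"
  unfolding pull_eq by (intro subst_gen_wedge_gen one_form_anticomm pull_gen_deg)

lemma pull_scalar: "pull J (scalar c) = scalar c"
  by (simp add: pull_eq subst_gen_scalar)

text \<open>The vector field \<open>\<partial>/\<partial>z\<^sup>j\<close> is pushed forward to \<open>\<Sum>\<^sub>i J\<^sub>i\<^sub>j \<partial>/\<partial>w\<^sup>i\<close>.  Both sides are antiderivations along
the pullback, so that it suffices to compare them on generators.\<close>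

lemma iprod_pull:
  "iprod (Hol j) (pull J \<omega>) = (\<Sum>i\<in>UNIV. scl (J $ i $ j) (pull J (iprod (Hol i) \<omega>)))"
proof (induction \<omega> rule: ext_induct)
  case one
  then show ?case by (simp add: pull_scalar lin_0[OF lin_pull])
next
  case (add \<alpha> \<beta>)
  then show ?case
    by (simp add: lin_add[OF lin_pull] lin_add[OF lin_iprod] scl_distrib sum.distrib)
next
  case (scl c \<alpha>)
  then show ?case
    by (simp add: lin_scl[OF lin_pull] lin_scl[OF lin_iprod] scl_sum mult.commute)
next
  case (gen a \<alpha>)
  have "(\<Sum>i\<in>UNIV. scl (J $ i $ j) (pull J (iprod (Hol i) (gen a \<and>\<^sub>w \<alpha>)))) =
     (\<Sum>i\<in>UNIV. scl (J $ i $ j) (if Hol i = a then pull J \<alpha> else 0)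
        - pull_gen J a \<and>\<^sub>w scl (J $ i $ j) (pull J (iprod (Hol i) \<alpha>)))"
    by (rule sum.cong)
      (simp_all add: iprod_gen_wedge lin_diff[OF lin_pull] pull_gen_wedge wedge_scl_right
        scl_diff lin_0[OF lin_pull])
  also have "\<dots> = (\<Sum>i\<in>UNIV. scl (J $ i $ j) (if Hol i = a then pull J \<alpha> else 0))
        - pull_gen J a \<and>\<^sub>w iprod (Hol j) (pull J \<alpha>)"
    by (simp add: sum_subtractf gen wedge_sum_right)
  also have "(\<Sum>i\<in>UNIV. scl (J $ i $ j) (if Hol i = a then pull J \<alpha> else 0)) = scl (pull_gen J a {Hol j}) (pull J \<alpha>)"
    by (cases a) (simp_all add: pull_gen_Hol if_distrib cong: if_cong)
  finally show ?case
    by (simp add: pull_gen_wedge iprod_one_form_wedge[OF pull_gen_deg])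
qed

section \<open>Contraction with tangent-valued forms at a point\<close>

lemma iprod_one_form:
  assumes "\<alpha> \<in> ext_deg 1"
  shows "iprod a \<alpha> = scalar (\<alpha> {a})"
  using iprod_one_form_wedge[OF assms, of a "scalar 1"]
  by (simp add: wedge_zero_right scalar_wedge) (simp add: scalar_eq_scl)

text \<open>Contraction at a single point, in coordinates: \<open>\<phi> i\<close> is the coefficient of \<open>\<partial>/\<partial>z\<^sup>i\<close>.\<close>

definition contract_at :: "('n::{finite,linorder} \<Rightarrow> 'n ext) \<Rightarrow> 'n ext \<Rightarrow> 'n ext" where
  "contract_at \<phi> \<omega> = (\<Sum>i\<in>UNIV. \<phi> i \<and>\<^sub>w iprod (Hol i) \<omega>)"

lemma lin_contract_at: "ext_linear (contract_at \<phi>)"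
  by (simp add: ext_linear_simps contract_at_def sum.distrib scl_sum)

lemmas contract_at_add = lin_add[OF lin_contract_at]
lemmas contract_at_scl = lin_scl[OF lin_contract_at]
lemmas contract_at_sum = lin_sum[OF lin_contract_at]
lemmas contract_at_zero [simp] = lin_0[OF lin_contract_at]

lemma ext_bideg_subset_deg: "ext_bideg p q \<subseteq> (ext_deg (p + q) :: 'n::{finite,linorder} ext set)"
proof -
  have "card S = card {i. Hol i \<in> S} + card {i. Anti i \<in> S}" for S :: "'n cidx set"
  proof -
    have "S = Hol ` {i. Hol i \<in> S} \<union> Anti ` {i. Anti i \<in> S}"
      by (auto simp: image_iff) (metis cidx.exhaust)
    then have "card S = card (Hol ` {i. Hol i \<in> S} \<union> Anti ` {i. Anti i \<in> S})" by simp
    also have "\<dots> = card {i. Hol i \<in> S} + card {i. Anti i \<in> S}"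
      by (subst card_Un_disjoint) (auto simp: card_image inj_on_def intro: finite_imageI finite_subset[OF subset_UNIV])
    finally show ?thesis .
  qed
  then show ?thesis by (auto simp: ext_deg_def ext_bideg_def)
qed

lemma dbar_one_form_deg: "\<alpha> \<in> ext_bideg 0 1 \<Longrightarrow> \<alpha> \<in> ext_deg 1"
  for \<alpha> :: "'n::{finite,linorder} ext"
  using subsetD[OF ext_bideg_subset_deg, of \<alpha> 0 1] by simp

lemma dbar_one_form_Hol: "\<alpha> \<in> ext_bideg 0 1 \<Longrightarrow> \<alpha> {Hol j} = 0"
  by (auto simp: ext_bideg_def)

text \<open>Contraction is a derivation without sign: moving the 1-form \<open>\<phi> i\<close> past \<open>\<theta>\<close> compensates the sign of
the antiderivation \<open>iprod\<close>.\<close>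

lemma contract_at_one_form_wedge:
  assumes \<phi>: "\<And>i. \<phi> i \<in> ext_bideg 0 1" and \<theta>: "\<theta> \<in> ext_deg 1"
  shows "contract_at \<phi> (\<theta> \<and>\<^sub>w \<omega>) = contract_at \<phi> \<theta> \<and>\<^sub>w \<omega> + \<theta> \<and>\<^sub>w contract_at \<phi> \<omega>"
proof -
  have "\<phi> i \<and>\<^sub>w iprod (Hol i) (\<theta> \<and>\<^sub>w \<omega>) = (\<phi> i \<and>\<^sub>w iprod (Hol i) \<theta>) \<and>\<^sub>w \<omega> + \<theta> \<and>\<^sub>w \<phi> i \<and>\<^sub>w iprod (Hol i) \<omega>" for i
  proof -
    have "\<phi> i \<and>\<^sub>w \<theta> \<and>\<^sub>w iprod (Hol i) \<omega> = (- (\<theta> \<and>\<^sub>w \<phi> i)) \<and>\<^sub>w iprod (Hol i) \<omega>"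
      using one_form_anticomm[OF dbar_one_form_deg[OF \<phi>] \<theta>] by (simp flip: wedge_assoc)
    then have "\<phi> i \<and>\<^sub>w \<theta> \<and>\<^sub>w iprod (Hol i) \<omega> = - (\<theta> \<and>\<^sub>w \<phi> i \<and>\<^sub>w iprod (Hol i) \<omega>)"
      by (simp add: wedge_minus_left wedge_assoc)
    then show ?thesis
      by (simp add: iprod_one_form_wedge[OF \<theta>] iprod_one_form[OF \<theta>] wedge_scl_left wedge_scl_right
          lin_diff[OF lin_wedge_right])
  qed
  then show ?thesis
    by (simp add: contract_at_def sum.distrib wedge_sum_left wedge_sum_right)
qed

lemma contract_at_dbar_one_form:
  assumes "\<alpha> \<in> ext_bideg 0 1"
  shows "contract_at \<phi> \<alpha> = 0"
  using iprod_one_form[OF dbar_one_form_deg[OF assms]]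
  by (simp add: contract_at_def dbar_one_form_Hol[OF assms])

lemma bideg_closed:
  "0 \<in> ext_bideg p q" "\<alpha> \<in> ext_bideg p q \<Longrightarrow> \<beta> \<in> ext_bideg p q \<Longrightarrow> \<alpha> + \<beta> \<in> ext_bideg p q"
  "\<alpha> \<in> ext_bideg p q \<Longrightarrow> scl c \<alpha> \<in> ext_bideg p q"
  by (auto simp: ext_bideg_def scl_def fun_apply_simps) (metis add.right_neutral)+

lemma bideg_sum: "(\<And>i. i \<in> I \<Longrightarrow> f i \<in> ext_bideg p q) \<Longrightarrow> (\<Sum>i\<in>I. f i) \<in> ext_bideg p q"
  by (induction I rule: infinite_finite_induct) (auto simp: bideg_closed)

lemma contract_at_one_form_dbar:
  assumes \<phi>: "\<And>i. \<phi> i \<in> ext_bideg 0 1" and \<theta>: "\<theta> \<in> ext_deg 1"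
  shows "contract_at \<phi> \<theta> \<in> ext_bideg 0 1"
  unfolding contract_at_def using \<phi> by (intro bideg_sum) (auto simp: iprod_one_form[OF \<theta>] bideg_closed)

text \<open>In the composition, \<open>iprod\<close> does not see the coefficients, which are of type \<open>(0,1)\<close>.  So it is
\<open>- \<Sum> \<phi>\<^sup>i \<and> \<psi>\<^sup>j \<and> iprod i (iprod j \<omega>)\<close>, and exchanging \<open>\<phi>\<close> and \<open>\<psi>\<close> yields two signs.\<close>

lemma contract_at_comm:
  assumes \<phi>: "\<And>i. \<phi> i \<in> ext_bideg 0 1" and \<psi>: "\<And>i. \<psi> i \<in> ext_bideg 0 1"
  shows "contract_at \<phi> (contract_at \<psi> \<omega>) = contract_at \<psi> (contract_at \<phi> \<omega>)"
proof -
  have *: "contract_at \<phi> (\<psi> j \<and>\<^sub>w \<xi>) = \<psi> j \<and>\<^sub>w contract_at \<phi> \<xi>" if "\<And>i. \<phi> i \<in> ext_bideg 0 1" "\<And>i. \<psi> i \<in> ext_bideg 0 1" for \<phi> \<psi> j \<xi>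
    using contract_at_one_form_wedge[OF that(1) dbar_one_form_deg[OF that(2), of j], where \<omega> = \<xi>]
    by (simp add: contract_at_dbar_one_form[OF that(2)])
  have 1: "contract_at \<phi> (\<psi> j \<and>\<^sub>w \<xi>) = \<psi> j \<and>\<^sub>w contract_at \<phi> \<xi>" for j \<xi>
    by (rule *) (rule \<phi> \<psi>)+
  have 2: "contract_at \<psi> (\<phi> j \<and>\<^sub>w \<xi>) = \<phi> j \<and>\<^sub>w contract_at \<psi> \<xi>" for j \<xi>
    by (rule *) (rule \<phi> \<psi>)+
  have "contract_at \<phi> (contract_at \<psi> \<omega>) = (\<Sum>j\<in>UNIV. \<Sum>i\<in>UNIV. \<psi> j \<and>\<^sub>w \<phi> i \<and>\<^sub>w iprod (Hol i) (iprod (Hol j) \<omega>))"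
    unfolding contract_at_def[of \<psi>] contract_at_sum 1 by (simp add: contract_at_def wedge_sum_right)
  also have "\<dots> = (\<Sum>j\<in>UNIV. \<Sum>i\<in>UNIV. \<phi> i \<and>\<^sub>w \<psi> j \<and>\<^sub>w iprod (Hol j) (iprod (Hol i) \<omega>))"
  proof (intro sum.cong refl)
    fix i j
    have "\<psi> j \<and>\<^sub>w \<phi> i \<and>\<^sub>w iprod (Hol i) (iprod (Hol j) \<omega>) = (\<psi> j \<and>\<^sub>w \<phi> i) \<and>\<^sub>w iprod (Hol i) (iprod (Hol j) \<omega>)"
      by (simp only: wedge_assoc)
    also have "\<dots> = (- (\<phi> i \<and>\<^sub>w \<psi> j)) \<and>\<^sub>w (- iprod (Hol j) (iprod (Hol i) \<omega>))"
      by (simp only: one_form_anticomm[OF dbar_one_form_deg[OF \<psi>] dbar_one_form_deg[OF \<phi>]]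
          iprod_anticomm[of "Hol i"])
    finally show "\<psi> j \<and>\<^sub>w \<phi> i \<and>\<^sub>w iprod (Hol i) (iprod (Hol j) \<omega>) = \<phi> i \<and>\<^sub>w \<psi> j \<and>\<^sub>w iprod (Hol j) (iprod (Hol i) \<omega>)"
      by (simp add: wedge_minus_left wedge_minus_right wedge_assoc)
  qed
  also have "\<dots> = (\<Sum>i\<in>UNIV. \<Sum>j\<in>UNIV. \<phi> i \<and>\<^sub>w \<psi> j \<and>\<^sub>w iprod (Hol j) (iprod (Hol i) \<omega>))"
    by (rule sum.swap)
  also have "\<dots> = contract_at \<psi> (contract_at \<phi> \<omega>)"
    unfolding contract_at_def[of \<phi>] contract_at_sum 2 by (simp add: contract_at_def wedge_sum_right)
  finally show ?thesis .
qed

text \<open>For commuting derivations \<open>i\<^sub>\<phi>\<close> and \<open>i\<^sub>\<psi>\<close>, the difference of the two sides is \<open>(i\<^sub>\<psi> (i\<^sub>\<phi> \<theta>)) \<and> \<omega>\<close>.  It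
vanishes because \<open>i\<^sub>\<phi> \<theta>\<close> is of type \<open>(0,1)\<close>.\<close>

lemma contract_at_contract_at_one_form_wedge:
  assumes \<phi>: "\<And>i. \<phi> i \<in> ext_bideg 0 1" and \<psi>: "\<And>i. \<psi> i \<in> ext_bideg 0 1" and \<theta>: "\<theta> \<in> ext_deg 1"
  shows "contract_at \<psi> (contract_at \<phi> (\<theta> \<and>\<^sub>w \<omega>)) =
    contract_at \<phi> (\<theta> \<and>\<^sub>w contract_at \<psi> \<omega>) - \<theta> \<and>\<^sub>w contract_at \<psi> (contract_at \<phi> \<omega>) + contract_at \<psi> (\<theta> \<and>\<^sub>w contract_at \<phi> \<omega>)"
proof -
  have "contract_at \<psi> (contract_at \<phi> \<theta> \<and>\<^sub>w \<omega>) = contract_at \<phi> \<theta> \<and>\<^sub>w contract_at \<psi> \<omega>"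
    using contract_at_one_form_wedge[OF \<psi> dbar_one_form_deg[OF contract_at_one_form_dbar[OF \<phi> \<theta>]], where \<omega> = \<omega>]
    by (simp add: contract_at_dbar_one_form[OF contract_at_one_form_dbar[OF \<phi> \<theta>]])
  then show ?thesis
    by (simp add: contract_at_one_form_wedge[OF \<phi> \<theta>] contract_at_one_form_wedge[OF \<psi> \<theta>] contract_at_add contract_at_comm[OF \<phi> \<psi>])
qed

text \<open>The pointwise form of the theorem.  One component of the \<open>V\<close>-valued form has the value \<open>\<omega>\<close> and the partial
derivatives \<open>d\<omega> a\<close>, and \<open>w\<close> collects the values of all components; \<open>d\<phi> a\<close> and \<open>d\<psi> a\<close> are the derivatives of \<open>\<phi>\<close>
and \<open>\<psi>\<close>, and \<open>\<theta>\<close> is a row of the connection matrix.  Treating the derivatives as independent data makes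
the statement purely algebraic.\<close>

lemma contract_at_bracket:
  fixes \<phi> \<psi> :: "'n::{finite,linorder} \<Rightarrow> 'n ext" and d\<phi> d\<psi> :: "'n cidx \<Rightarrow> 'n \<Rightarrow> 'n ext"
    and \<omega> :: "'n ext" and d\<omega> :: "'n cidx \<Rightarrow> 'n ext"
    and \<theta> w :: "'r::finite \<Rightarrow> 'n ext"
  assumes \<phi>: "\<And>i. \<phi> i \<in> ext_bideg 0 1" and \<psi>: "\<And>i. \<psi> i \<in> ext_bideg 0 1"
    and d\<phi>: "\<And>a i. d\<phi> a i \<in> ext_bideg 0 1" and d\<psi>: "\<And>a i. d\<psi> a i \<in> ext_bideg 0 1"
    and \<theta>: "\<And>b. \<theta> b \<in> ext_deg 1"
  shows "contract_at (\<lambda>j. \<Sum>i\<in>UNIV. \<phi> i \<and>\<^sub>w d\<psi> (Hol i) j + \<psi> i \<and>\<^sub>w d\<phi> (Hol i) j) \<omega> =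
    contract_at \<phi> ((\<Sum>a\<in>UNIV. gen a \<and>\<^sub>w (contract_at (d\<psi> a) \<omega> + contract_at \<psi> (d\<omega> a))) + (\<Sum>b\<in>UNIV. \<theta> b \<and>\<^sub>w contract_at \<psi> (w b)))
    - ((\<Sum>a\<in>UNIV. gen a \<and>\<^sub>w (contract_at (d\<psi> a) (contract_at \<phi> \<omega>) + contract_at \<psi> (contract_at (d\<phi> a) \<omega> + contract_at \<phi> (d\<omega> a))))
        + (\<Sum>b\<in>UNIV. \<theta> b \<and>\<^sub>w contract_at \<psi> (contract_at \<phi> (w b))))
    + contract_at \<psi> ((\<Sum>a\<in>UNIV. gen a \<and>\<^sub>w (contract_at (d\<phi> a) \<omega> + contract_at \<phi> (d\<omega> a))) + (\<Sum>b\<in>UNIV. \<theta> b \<and>\<^sub>w contract_at \<phi> (w b)))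
    - contract_at \<psi> (contract_at \<phi> ((\<Sum>a\<in>UNIV. gen a \<and>\<^sub>w d\<omega> a) + (\<Sum>b\<in>UNIV. \<theta> b \<and>\<^sub>w w b)))"
    (is "?L = contract_at \<phi> (?A1 + ?B1) - (?A2 + ?B2) + contract_at \<psi> (?A3 + ?B3) - contract_at \<psi> (contract_at \<phi> (?A4 + ?B4))")
proof -
  \<comment> \<open>The connection terms cancel among themselves.\<close>
  have B: "contract_at \<psi> (contract_at \<phi> ?B4) = contract_at \<phi> ?B1 - ?B2 + contract_at \<psi> ?B3"
    by (simp add: contract_at_sum contract_at_contract_at_one_form_wedge[OF \<phi> \<psi> \<theta>] sum.distrib sum_subtractf)
  \<comment> \<open>The terms with a derivative of the form cancel in the same way, with \<open>gen a\<close> in the role of \<open>\<theta>\<close>.\<close>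
  have A: "contract_at \<phi> ?A1 - ?A2 + contract_at \<psi> ?A3 - contract_at \<psi> (contract_at \<phi> ?A4) =
    (\<Sum>a\<in>UNIV. contract_at \<phi> (gen a) \<and>\<^sub>w contract_at (d\<psi> a) \<omega> + contract_at \<psi> (gen a) \<and>\<^sub>w contract_at (d\<phi> a) \<omega>)"
    unfolding contract_at_sum sum_subtractf[symmetric] sum.distrib[symmetric]
    by (intro sum.cong refl)
      (simp only: contract_at_contract_at_one_form_wedge[OF \<phi> \<psi> gen_deg] contract_at_add wedge_add_right,
        simp add: contract_at_one_form_wedge[OF \<phi> gen_deg] contract_at_one_form_wedge[OF \<psi> gen_deg] contract_at_comm[OF \<phi> d\<psi>])
  have c: "contract_at \<phi> (gen a) = (case a of Hol i \<Rightarrow> \<phi> i | Anti i \<Rightarrow> 0)" for \<phi> :: "'n \<Rightarrow> 'n ext" and a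
  proof -
    have "contract_at \<phi> (gen a) = (\<Sum>i\<in>UNIV. if a = Hol i then \<phi> i else 0)"
      unfolding contract_at_def by (rule sum.cong) (simp_all add: iprod_one_form[OF gen_deg], simp add: gen_def)
    then show ?thesis by (cases a) simp_all
  qed
  have U: "(\<Sum>a\<in>UNIV. f a) = (\<Sum>i\<in>UNIV. f (Hol i)) + (\<Sum>i\<in>UNIV. f (Anti i))" for f :: "'n cidx \<Rightarrow> 'n ext"
  proof -
    have "(UNIV :: 'n cidx set) = range Hol \<union> range Anti"
      by (auto simp: image_iff) (metis cidx.exhaust)
    moreover have "sum f (range Hol \<union> range Anti) = sum f (range Hol) + sum f (range Anti)"
      by (rule sum.union_disjoint) auto
    ultimately have "(\<Sum>a\<in>UNIV. f a) = sum f (range Hol) + sum f (range Anti)" by metis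
    also have "\<dots> = (\<Sum>i\<in>UNIV. f (Hol i)) + (\<Sum>i\<in>UNIV. f (Anti i))"
      by (subst (1 2) sum.reindex) (auto simp: inj_on_def o_def)
    finally show ?thesis .
  qed
  have "?L = (\<Sum>j\<in>UNIV. \<Sum>i\<in>UNIV. \<phi> i \<and>\<^sub>w d\<psi> (Hol i) j \<and>\<^sub>w iprod (Hol j) \<omega> + \<psi> i \<and>\<^sub>w d\<phi> (Hol i) j \<and>\<^sub>w iprod (Hol j) \<omega>)"
    by (simp add: contract_at_def wedge_sum_left wedge_add_left wedge_assoc)
  also have "\<dots> = (\<Sum>i\<in>UNIV. \<Sum>j\<in>UNIV. \<phi> i \<and>\<^sub>w d\<psi> (Hol i) j \<and>\<^sub>w iprod (Hol j) \<omega> + \<psi> i \<and>\<^sub>w d\<phi> (Hol i) j \<and>\<^sub>w iprod (Hol j) \<omega>)"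
    by (rule sum.swap)
  also have "\<dots> = (\<Sum>i\<in>UNIV. \<phi> i \<and>\<^sub>w contract_at (d\<psi> (Hol i)) \<omega> + \<psi> i \<and>\<^sub>w contract_at (d\<phi> (Hol i)) \<omega>)"
    by (simp add: contract_at_def wedge_sum_right sum.distrib)
  also have "\<dots> = contract_at \<phi> ?A1 - ?A2 + contract_at \<psi> ?A3 - contract_at \<psi> (contract_at \<phi> ?A4)"
    unfolding A by (subst U) (simp add: c)
  finally show ?thesis unfolding contract_at_add B by (simp add: algebra_simps)
qed

text \<open>The hypothesis is the transformation rule of tangent-valued forms.\<close>

lemma pull_contract_at:
  assumes "\<And>i. pull J (\<phi>' i) = (\<Sum>j\<in>UNIV. scl (J $ i $ j) (\<phi> j))"
  shows "pull J (contract_at \<phi>' \<omega>) = contract_at \<phi> (pull J \<omega>)"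
proof -
  have "pull J (contract_at \<phi>' \<omega>) = (\<Sum>i\<in>UNIV. \<Sum>j\<in>UNIV. scl (J $ i $ j) (\<phi> j \<and>\<^sub>w pull J (iprod (Hol i) \<omega>)))"
    by (simp add: contract_at_def lin_sum[OF lin_pull] pull_wedge assms wedge_sum_left wedge_scl_left)
  also have "\<dots> = (\<Sum>j\<in>UNIV. \<Sum>i\<in>UNIV. scl (J $ i $ j) (\<phi> j \<and>\<^sub>w pull J (iprod (Hol i) \<omega>)))"
    by (rule sum.swap)
  also have "\<dots> = contract_at \<phi> (pull J \<omega>)"
    by (simp add: contract_at_def iprod_pull wedge_sum_right wedge_scl_right)
  finally show ?thesis .
qed

lemma wedge_deg:
  assumes "\<alpha> \<in> ext_deg p" "\<beta> \<in> ext_deg q"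
  shows "\<alpha> \<and>\<^sub>w \<beta> \<in> ext_deg (p + q)"
proof -
  have "card S = p + q" if "(\<alpha> \<and>\<^sub>w \<beta>) S \<noteq> 0" for S
  proof -
    from that obtain A where A: "A \<subseteq> S" "\<alpha> A \<noteq> 0" "\<beta> (S - A) \<noteq> 0"
      unfolding wedge_def by (metis (no_types, lifting) PowD mult_eq_0_iff sum.neutral)
    then have "card A = p" "card (S - A) = q" using assms by (auto simp: ext_deg_def)
    then show ?thesis using A(1) card_mono[OF finite A(1)] by (simp add: card_Diff_subset)
  qed
  then show ?thesis by (simp add: ext_deg_def)
qed

lemma iprod_deg:
  assumes "\<omega> \<in> ext_deg (Suc k)"
  shows "iprod a \<omega> \<in> ext_deg k"
  using assms by (force simp: ext_deg_def iprod_def split: if_splits)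

lemma iprod_deg_0:
  assumes "\<omega> \<in> ext_deg 0"
  shows "iprod a \<omega> = 0"
  using assms by (auto simp: ext_deg_def iprod_def fun_eq_iff fun_apply_simps)

text \<open>In degree 0 the contraction is 0, which has every degree.\<close>

lemma contract_at_deg:
  assumes "\<And>i. \<phi> i \<in> ext_deg 1" "\<omega> \<in> ext_deg k"
  shows "contract_at \<phi> \<omega> \<in> ext_deg k"
proof (cases k)
  case 0
  with assms show ?thesis by (auto simp: contract_at_def iprod_deg_0)
next
  case (Suc m)
  with wedge_deg[OF assms(1) iprod_deg] assms(2) show ?thesis by (auto simp: contract_at_def)
qed

section \<open>The algebra of smooth functions\<close>

lemma Ck_on_cong:
  "open S \<Longrightarrow> (\<And>x. x \<in> S \<Longrightarrow> f x = g x) \<Longrightarrow> Ck_on k S f \<Longrightarrow> Ck_on k S g"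
proof (induction k arbitrary: f g)
  case 0
  then show ?case by (simp cong: continuous_on_cong)
next
  case (Suc k)
  have d: "f differentiable (at x)" if "x \<in> S" for x using Suc.prems(3) that by simp
  have "g differentiable (at x)" if "x \<in> S" for x
    using d[OF that] Suc.prems(1,2) that unfolding differentiable_def
    by (metis has_derivative_transform_within_open)
  moreover have "frechet_derivative f (at x) = frechet_derivative g (at x)" if "x \<in> S" for x
    using frechet_derivative_transform_within_open[OF d[OF that] Suc.prems(1) that Suc.prems(2)] by simp
  then have "Ck_on k S (\<lambda>x. frechet_derivative g (at x) v)" for v
    using Suc.IH[OF Suc.prems(1), of "\<lambda>x. frechet_derivative f (at x) v" "\<lambda>x. frechet_derivative g (at x) v"]
      Suc.prems(3) by simp
  ultimately show ?case by simp
qed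

lemma Ck_on_subset: "Ck_on k S f \<Longrightarrow> T \<subseteq> S \<Longrightarrow> Ck_on k T f"
  by (induction k arbitrary: f) (auto intro: continuous_on_subset)

lemma Ck_on_SucD: "Ck_on (Suc k) S f \<Longrightarrow> Ck_on k S f"
proof (induction k arbitrary: f)
  case 0
  then show ?case
    by (simp add: continuous_at_imp_continuous_on differentiable_imp_continuous_within)
next
  case (Suc k)
  then show ?case by (metis Ck_on.simps(2))
qed

lemma Ck_on_const: "Ck_on k S (\<lambda>x. c)"
proof (induction k arbitrary: c)
  case (Suc k)
  have "(\<lambda>x. frechet_derivative (\<lambda>x. c) (at x) v) = (\<lambda>x. 0)" for v :: 'a
    by (simp add: frechet_derivative_const)
  with Suc show ?case by simp
qed simp

lemma frechet_derivative_add: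
  assumes "f differentiable (at x)" "g differentiable (at x)"
  shows "frechet_derivative (\<lambda>x. f x + g x) (at x) v =
    frechet_derivative f (at x) v + frechet_derivative g (at x) v"
proof -
  have "((\<lambda>x. f x + g x) has_derivative
     (\<lambda>v. frechet_derivative f (at x) v + frechet_derivative g (at x) v)) (at x)"
    using assms by (intro has_derivative_add) (simp_all add: frechet_derivative_works)
  from frechet_derivative_at[OF this] show ?thesis by metis
qed

lemma Ck_on_add:
  "open S \<Longrightarrow> Ck_on k S f \<Longrightarrow> Ck_on k S g \<Longrightarrow> Ck_on k S (\<lambda>x. f x + g x)"
proof (induction k arbitrary: f g)
  case (Suc k)
  have *: "frechet_derivative f (at x) v + frechet_derivative g (at x) v =
      frechet_derivative (\<lambda>x. f x + g x) (at x) v" if "x \<in> S" for x v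
    using Suc.prems that by (simp add: frechet_derivative_add)
  have "Ck_on k S (\<lambda>x. frechet_derivative (\<lambda>x. f x + g x) (at x) v)" for v
    by (rule Ck_on_cong[OF Suc.prems(1) *[of _ v] Suc.IH]) (use Suc.prems in auto)
  with Suc.prems show ?case by simp
qed (simp add: continuous_on_add)

lemma frechet_derivative_times:
  fixes f g :: "'a::real_normed_vector \<Rightarrow> 'b::real_normed_algebra"
  assumes "f differentiable (at x)" "g differentiable (at x)"
  shows "frechet_derivative (\<lambda>x. f x * g x) (at x) v =
    f x * frechet_derivative g (at x) v + frechet_derivative f (at x) v * g x"
proof -
  have "((\<lambda>x. f x * g x) has_derivative
     (\<lambda>v. f x * frechet_derivative g (at x) v + frechet_derivative f (at x) v * g x)) (at x)"
    using assms by (intro has_derivative_mult) (simp_all add: frechet_derivative_works)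
  from frechet_derivative_at[OF this] show ?thesis by metis
qed

lemma Ck_on_mult:
  fixes f g :: "'a::real_normed_vector \<Rightarrow> 'b::real_normed_algebra"
  shows "open S \<Longrightarrow> Ck_on k S f \<Longrightarrow> Ck_on k S g \<Longrightarrow> Ck_on k S (\<lambda>x. f x * g x)"
proof (induction k arbitrary: f g)
  case (Suc k)
  have *: "f x * frechet_derivative g (at x) v + frechet_derivative f (at x) v * g x =
      frechet_derivative (\<lambda>x. f x * g x) (at x) v" if "x \<in> S" for x v
    using Suc.prems that by (simp add: frechet_derivative_times)
  have "Ck_on k S (\<lambda>x. frechet_derivative (\<lambda>x. f x * g x) (at x) v)" for v
    by (rule Ck_on_cong[OF Suc.prems(1) *[of _ v]])
      (use Suc.prems Ck_on_SucD[of k S f] Ck_on_SucD[of k S g] in \<open>auto intro!: Ck_on_add Suc.IH\<close>)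
  with Suc.prems show ?case by simp
qed (simp add: continuous_on_mult)

lemma smooth_on_cong:
  "open S \<Longrightarrow> (\<And>x. x \<in> S \<Longrightarrow> f x = g x) \<Longrightarrow> smooth_on S f \<Longrightarrow> smooth_on S g"
  unfolding smooth_on_def using Ck_on_cong by blast

lemma smooth_on_subset: "smooth_on S f \<Longrightarrow> T \<subseteq> S \<Longrightarrow> smooth_on T f"
  unfolding smooth_on_def using Ck_on_subset by blast

lemma smooth_on_const: "smooth_on S (\<lambda>x. c)"
  by (simp add: smooth_on_def Ck_on_const)

lemma smooth_on_add:
  "open S \<Longrightarrow> smooth_on S f \<Longrightarrow> smooth_on S g \<Longrightarrow> smooth_on S (\<lambda>x. f x + g x)"
  by (simp add: smooth_on_def Ck_on_add)

lemma smooth_on_mult: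
  fixes f g :: "'a::real_normed_vector \<Rightarrow> 'b::real_normed_algebra"
  shows "open S \<Longrightarrow> smooth_on S f \<Longrightarrow> smooth_on S g \<Longrightarrow> smooth_on S (\<lambda>x. f x * g x)"
  by (simp add: smooth_on_def Ck_on_mult)

lemma smooth_on_sum:
  "open S \<Longrightarrow> (\<And>i. i \<in> I \<Longrightarrow> smooth_on S (f i)) \<Longrightarrow> smooth_on S (\<lambda>x. \<Sum>i\<in>I. f i x)"
  by (induction I rule: infinite_finite_induct) (auto simp: smooth_on_const smooth_on_add)

lemma smooth_on_differentiable: "smooth_on S f \<Longrightarrow> x \<in> S \<Longrightarrow> f differentiable (at x)"
  unfolding smooth_on_def by (metis Ck_on.simps(2))

section \<open>Calculus in a chart\<close>

text \<open>Charts and trivializations are pairs, but are meant as single objects.\<close>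

declare split_paired_All [simp del] split_paired_Ex [simp del]

lemma chart_open_image:
  assumes "complex_manifold \<A>" "c \<in> \<A>" "open U"
  shows "open (snd c ` (U \<inter> cdom c))"
proof -
  have o: "open (cdom c)" "open (snd c ` cdom c)"
    and h: "homeomorphism (cdom c) (snd c ` cdom c) (snd c) (inv_into (cdom c) (snd c))"
    using assms(1,2) by (auto simp: complex_manifold_def)
  have "openin (top_of_set (cdom c)) (U \<inter> cdom c)"
    using assms(3) by (simp add: openin_open Int_commute) blast
  then have "openin (top_of_set (snd c ` cdom c)) (snd c ` (U \<inter> cdom c))"
    by (rule homeomorphism_imp_open_map[OF h])
  then show ?thesis using o(2) openin_open_trans by blast
qed

lemma chart_inv:
  assumes "complex_manifold \<A>" "c \<in> \<A>" "x \<in> cdom c"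
  shows "inv_into (cdom c) (snd c) (snd c x) = x"
  using assms unfolding complex_manifold_def by (metis homeomorphism_apply1)

lemma loc_at:
  assumes "complex_manifold \<A>" "c \<in> \<A>" "x \<in> cdom c"
  shows "loc c f (snd c x) = f x"
  by (simp add: loc_def chart_inv[OF assms])

text \<open>The condition that \<open>smooth_fun\<close> and \<open>smooth_ext\<close> impose in one chart.\<close>

definition chart_smooth :: "('m, 'n::finite) chart \<Rightarrow> 'm set \<Rightarrow> ('m \<Rightarrow> complex) \<Rightarrow> bool" where
  "chart_smooth c U f \<longleftrightarrow> smooth_on (snd c ` (U \<inter> cdom c)) (loc c f)"

context
  fixes \<A> :: "('m::topological_space, 'n::{finite,linorder}) chart set" and c
  assumes M: "complex_manifold \<A>" and c: "c \<in> \<A>"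
begin

lemma chart_smooth_cong:
  assumes "open U" "\<And>x. x \<in> U \<inter> cdom c \<Longrightarrow> f x = g x" "chart_smooth c U f"
  shows "chart_smooth c U g"
  unfolding chart_smooth_def
  by (rule smooth_on_cong[OF chart_open_image[OF M c assms(1)] _ assms(3)[unfolded chart_smooth_def]])
    (auto simp: loc_at[OF M c] assms(2))

lemma chart_smooth_subset: "chart_smooth c U f \<Longrightarrow> V \<inter> cdom c \<subseteq> U \<Longrightarrow> chart_smooth c V f"
  unfolding chart_smooth_def by (erule smooth_on_subset) auto

lemma chart_smooth_const: "chart_smooth c U (\<lambda>x. k)"
  by (simp add: chart_smooth_def loc_def o_def smooth_on_const)

lemma chart_smooth_add:
  "open U \<Longrightarrow> chart_smooth c U f \<Longrightarrow> chart_smooth c U g \<Longrightarrow> chart_smooth c U (\<lambda>x. f x + g x)"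
  using smooth_on_add[OF chart_open_image[OF M c]] by (fastforce simp: chart_smooth_def loc_def o_def)

lemma chart_smooth_mult:
  "open U \<Longrightarrow> chart_smooth c U f \<Longrightarrow> chart_smooth c U g \<Longrightarrow> chart_smooth c U (\<lambda>x. f x * g x)"
  using smooth_on_mult[OF chart_open_image[OF M c]] by (fastforce simp: chart_smooth_def loc_def o_def)

lemma chart_smooth_sum:
  "open U \<Longrightarrow> (\<And>i. i \<in> I \<Longrightarrow> chart_smooth c U (f i)) \<Longrightarrow> chart_smooth c U (\<lambda>x. \<Sum>i\<in>I. f i x)"
  using smooth_on_sum[OF chart_open_image[OF M c], of U I "\<lambda>i. loc c (f i)"]
  by (simp add: chart_smooth_def loc_def o_def)

lemma chart_smooth_differentiable:
  "chart_smooth c U f \<Longrightarrow> x \<in> U \<inter> cdom c \<Longrightarrow> loc c f differentiable (at (snd c x))"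
  unfolding chart_smooth_def by (rule smooth_on_differentiable) auto

lemma cdiff_const: "cdiff c a (\<lambda>x. k) x = 0"
  by (cases a) (simp_all add: cdiff_def wirtinger_def loc_def o_def frechet_derivative_const)

lemma cdiff_add:
  assumes "x \<in> U \<inter> cdom c" "chart_smooth c U f" "chart_smooth c U g"
  shows "cdiff c a (\<lambda>y. f y + g y) x = cdiff c a f x + cdiff c a g x"
proof -
  have "loc c (\<lambda>y. f y + g y) = (\<lambda>z. loc c f z + loc c g z)" by (auto simp: loc_def)
  then show ?thesis
    using frechet_derivative_add[OF assms(2,3)[THEN chart_smooth_differentiable, OF assms(1)]]
    by (cases a) (simp_all add: cdiff_def wirtinger_def Let_def field_simps)
qed

lemma cdiff_mult:
  assumes "x \<in> U \<inter> cdom c" "chart_smooth c U f" "chart_smooth c U g"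
  shows "cdiff c a (\<lambda>y. f y * g y) x = f x * cdiff c a g x + cdiff c a f x * g x"
proof -
  have "loc c (\<lambda>y. f y * g y) = (\<lambda>z. loc c f z * loc c g z)" by (auto simp: loc_def)
  moreover have "loc c f (snd c x) = f x" "loc c g (snd c x) = g x"
    using assms(1) loc_at[OF M c] by auto
  ultimately show ?thesis
    using frechet_derivative_times[OF assms(2,3)[THEN chart_smooth_differentiable, OF assms(1)]]
    by (cases a) (simp_all add: cdiff_def wirtinger_def Let_def field_simps)
qed

lemma cdiff_sum:
  assumes U: "open U" "x \<in> U \<inter> cdom c" and f: "\<And>i. i \<in> I \<Longrightarrow> chart_smooth c U (f i)"
  shows "cdiff c a (\<lambda>y. \<Sum>i\<in>I. f i y) x = (\<Sum>i\<in>I. cdiff c a (f i) x)"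
  using f
proof (induction I rule: infinite_finite_induct)
  case (insert i I)
  have "cdiff c a (\<lambda>y. f i y + (\<Sum>i\<in>I. f i y)) x = cdiff c a (f i) x + cdiff c a (\<lambda>y. \<Sum>i\<in>I. f i y) x"
    using insert.prems by (intro cdiff_add[OF U(2)] chart_smooth_sum[OF U(1)]) auto
  with insert show ?case by simp
qed (simp_all add: cdiff_const)

section \<open>Differentiation of local expressions of forms\<close>

lemma smooth_ext_iff: "smooth_ext c U \<alpha> \<longleftrightarrow> (\<forall>S. chart_smooth c U (\<lambda>x. \<alpha> x S))"
  by (simp add: smooth_ext_def chart_smooth_def)

lemma smooth_ext_cong:
  "open U \<Longrightarrow> (\<And>x. x \<in> U \<inter> cdom c \<Longrightarrow> \<alpha> x = \<beta> x) \<Longrightarrow> smooth_ext c U \<alpha> \<Longrightarrow> smooth_ext c U \<beta>"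
  unfolding smooth_ext_iff by (metis chart_smooth_cong)

lemma smooth_ext_subset: "smooth_ext c U \<alpha> \<Longrightarrow> V \<inter> cdom c \<subseteq> U \<Longrightarrow> smooth_ext c V \<alpha>"
  unfolding smooth_ext_iff using chart_smooth_subset by blast

lemma smooth_ext_wedge:
  "open U \<Longrightarrow> smooth_ext c U \<alpha> \<Longrightarrow> smooth_ext c U \<beta> \<Longrightarrow> smooth_ext c U (\<lambda>x. \<alpha> x \<and>\<^sub>w \<beta> x)"
  unfolding smooth_ext_iff wedge_def
  by (auto intro!: chart_smooth_sum chart_smooth_mult chart_smooth_const)

lemma smooth_ext_iprod:
  assumes "open U" "smooth_ext c U \<alpha>"
  shows "smooth_ext c U (\<lambda>x. iprod a (\<alpha> x))"
  unfolding smooth_ext_iff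
proof
  fix S
  have "chart_smooth c U (\<lambda>x. shuffle_sign {a} S * \<alpha> x (insert a S))"
    using assms by (intro chart_smooth_mult chart_smooth_const) (auto simp: smooth_ext_iff)
  then show "chart_smooth c U (\<lambda>x. iprod a (\<alpha> x) S)"
    by (cases "a \<in> S") (simp_all add: iprod_def chart_smooth_const)
qed

lemma smooth_ext_sum:
  "open U \<Longrightarrow> (\<And>i. i \<in> I \<Longrightarrow> smooth_ext c U (\<alpha> i)) \<Longrightarrow> smooth_ext c U (\<lambda>x. \<Sum>i\<in>I. \<alpha> i x)"
  unfolding smooth_ext_iff ext_sum_apply by (auto intro!: chart_smooth_sum)

lemma smooth_ext_contract_at:
  "open U \<Longrightarrow> (\<And>i. smooth_ext c U (\<lambda>x. \<phi> x i)) \<Longrightarrow> smooth_ext c U \<omega> \<Longrightarrow> smooth_ext c U (\<lambda>x. contract_at (\<phi> x) (\<omega> x))"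
  unfolding contract_at_def by (intro smooth_ext_sum smooth_ext_wedge smooth_ext_iprod)

lemma ext_diff_sum:
  assumes "open U" "x \<in> U \<inter> cdom c" "\<And>i. i \<in> I \<Longrightarrow> smooth_ext c U (\<alpha> i)"
  shows "ext_diff c a (\<lambda>y. \<Sum>i\<in>I. \<alpha> i y) x = (\<Sum>i\<in>I. ext_diff c a (\<alpha> i) x)"
  using assms(3) by (intro ext) (simp add: ext_diff_def ext_sum_apply cdiff_sum[OF assms(1,2)] smooth_ext_iff)

lemma ext_diff_wedge:
  assumes "open U" "x \<in> U \<inter> cdom c" "smooth_ext c U \<alpha>" "smooth_ext c U \<beta>"
  shows "ext_diff c a (\<lambda>y. \<alpha> y \<and>\<^sub>w \<beta> y) x = ext_diff c a \<alpha> x \<and>\<^sub>w \<beta> x + \<alpha> x \<and>\<^sub>w ext_diff c a \<beta> x"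
proof
  fix S
  have s: "chart_smooth c U (\<lambda>y. \<alpha> y T)" "chart_smooth c U (\<lambda>y. \<beta> y T)" for T
    using assms(3,4) by (auto simp: smooth_ext_iff)
  have "cdiff c a (\<lambda>y. shuffle_sign A (S - A) * \<alpha> y A * \<beta> y (S - A)) x =
     shuffle_sign A (S - A) * cdiff c a (\<lambda>y. \<alpha> y A) x * \<beta> x (S - A) +
     shuffle_sign A (S - A) * \<alpha> x A * cdiff c a (\<lambda>y. \<beta> y (S - A)) x" for A
    using s by (simp add: cdiff_mult[OF assms(2)] chart_smooth_mult[OF assms(1)] chart_smooth_const cdiff_const)
  then show "ext_diff c a (\<lambda>y. \<alpha> y \<and>\<^sub>w \<beta> y) x S = (ext_diff c a \<alpha> x \<and>\<^sub>w \<beta> x + \<alpha> x \<and>\<^sub>w ext_diff c a \<beta> x) S"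
    using s by (simp add: ext_diff_def wedge_def fun_apply_simps cdiff_sum[OF assms(1,2)]
      chart_smooth_mult[OF assms(1)] chart_smooth_const sum.distrib)
qed

lemma ext_diff_iprod:
  assumes "x \<in> U \<inter> cdom c" "smooth_ext c U \<alpha>"
  shows "ext_diff c a (\<lambda>y. iprod b (\<alpha> y)) x = iprod b (ext_diff c a \<alpha> x)"
  using assms(2)
  by (auto simp: ext_diff_def iprod_def smooth_ext_iff cdiff_const cdiff_mult[OF assms(1)] chart_smooth_const)

text \<open>Interior products have constant coefficients, so they commute with coefficientwise derivatives.\<close>

lemma ext_diff_contract_at:
  assumes U: "open U" "x \<in> U \<inter> cdom c" and \<phi>: "\<And>i. smooth_ext c U (\<lambda>x. \<phi> x i)" and \<omega>: "smooth_ext c U \<omega>"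
  shows "ext_diff c a (\<lambda>y. contract_at (\<phi> y) (\<omega> y)) x =
    contract_at (\<lambda>i. ext_diff c a (\<lambda>y. \<phi> y i) x) (\<omega> x) + contract_at (\<phi> x) (ext_diff c a \<omega> x)"
  unfolding contract_at_def
  by (simp add: ext_diff_sum[OF U] smooth_ext_wedge[OF U(1)] smooth_ext_iprod[OF U(1)] \<phi> \<omega>
      ext_diff_wedge[OF U] ext_diff_iprod[OF U(2)] sum.distrib)

lemma ext_diff_bideg:
  assumes "\<And>y. \<alpha> y \<in> ext_bideg p q"
  shows "ext_diff c a \<alpha> x \<in> ext_bideg p q"
proof -
  have "ext_diff c a \<alpha> x S = 0" if "\<not> (card {i. Hol i \<in> S} = p \<and> card {i. Anti i \<in> S} = q)" for S
  proof -
    have "\<alpha> y S = 0" for y using assms[of y] that by (auto simp: ext_bideg_def)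
    then show ?thesis by (simp add: ext_diff_def cdiff_const)
  qed
  then show ?thesis by (auto simp: ext_bideg_def)
qed

end

section \<open>Vector-valued forms\<close>

lemma formsD:
  assumes "\<omega> \<in> forms \<A> U L"
  shows forms_outside: "c \<notin> \<A> \<or> x \<notin> U \<inter> cdom c \<Longrightarrow> \<omega> c x = 0"
    and forms_in: "\<omega> c x \<in> L"
    and forms_smooth: "c \<in> \<A> \<Longrightarrow> smooth_ext c U (\<omega> c)"
    and forms_pull: "c \<in> \<A> \<Longrightarrow> c' \<in> \<A> \<Longrightarrow> x \<in> U \<inter> cdom c \<inter> cdom c' \<Longrightarrow>
      \<omega> c x = pull (jacobian c c' x) (\<omega> c' x)"
  using assms unfolding forms_def by blast+

lemma tformsD:
  assumes "\<phi> \<in> tforms \<A> U q"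
  shows tforms_bideg: "\<phi> c x i \<in> ext_bideg 0 q"
    and tforms_smooth: "c \<in> \<A> \<Longrightarrow> smooth_ext c U (\<lambda>x. \<phi> c x i)"
    and tforms_pull: "c \<in> \<A> \<Longrightarrow> c' \<in> \<A> \<Longrightarrow> x \<in> U \<inter> cdom c \<inter> cdom c' \<Longrightarrow>
      pull (jacobian c c' x) (\<phi> c' x i) = (\<Sum>j\<in>UNIV. scl (jacobian c c' x $ i $ j) (\<phi> c x j))"
  using assms unfolding tforms_def by blast+

lemma vformsD:
  assumes "\<eta> \<in> vforms \<A> \<pi> \<T> U L"
  shows vforms_outside: "t \<notin> \<T> \<Longrightarrow> \<eta> c t x a = 0"
    and vforms_forms: "t \<in> \<T> \<Longrightarrow> (\<lambda>c x. \<eta> c t x a) \<in> forms \<A> (U \<inter> cdom t) L"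
    and vforms_transition: "c \<in> \<A> \<Longrightarrow> t \<in> \<T> \<Longrightarrow> t' \<in> \<T> \<Longrightarrow> x \<in> U \<inter> cdom c \<inter> cdom t \<inter> cdom t' \<Longrightarrow>
      \<eta> c t' x a = (\<Sum>b\<in>UNIV. scl (transition \<pi> t t' x $ a $ b) (\<eta> c t x b))"
  using assms unfolding vforms_def by blast+

lemma vforms_zero_outside:
  assumes "\<eta> \<in> vforms \<A> \<pi> \<T> U L" "\<not> (c \<in> \<A> \<and> t \<in> \<T> \<and> x \<in> U \<inter> cdom c \<inter> cdom t)"
  shows "\<eta> c t x a = 0"
  using vforms_outside[OF assms(1)] forms_outside[OF vforms_forms[OF assms(1), of t a], of c x] assms(2)
  by blast

lemma vform_sum_apply: "(\<Sum>b\<in>B. f b) c t x a = (\<Sum>b\<in>B. f b c t x a)"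
  for f :: "'b \<Rightarrow> ('m, 'n, 'e, 'r) vform"
  by (induction B rule: infinite_finite_induct) (simp_all add: fun_apply_simps)

lemma vformsI:
  assumes "\<And>c t x a. t \<notin> \<T> \<Longrightarrow> \<eta> c t x a = 0"
    and "\<And>c t x a. t \<in> \<T> \<Longrightarrow> c \<notin> \<A> \<or> x \<notin> U \<inter> cdom t \<inter> cdom c \<Longrightarrow> \<eta> c t x a = 0"
    and "\<And>c t x a. t \<in> \<T> \<Longrightarrow> \<eta> c t x a \<in> L"
    and "\<And>c t a. t \<in> \<T> \<Longrightarrow> c \<in> \<A> \<Longrightarrow> smooth_ext c (U \<inter> cdom t) (\<lambda>x. \<eta> c t x a)"
    and "\<And>c c' t x a. t \<in> \<T> \<Longrightarrow> c \<in> \<A> \<Longrightarrow> c' \<in> \<A> \<Longrightarrow> x \<in> U \<inter> cdom t \<inter> cdom c \<inter> cdom c' \<Longrightarrow>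
      \<eta> c t x a = pull (jacobian c c' x) (\<eta> c' t x a)"
    and "\<And>c t t' x a. c \<in> \<A> \<Longrightarrow> t \<in> \<T> \<Longrightarrow> t' \<in> \<T> \<Longrightarrow> x \<in> U \<inter> cdom c \<inter> cdom t \<inter> cdom t' \<Longrightarrow>
      \<eta> c t' x a = (\<Sum>b\<in>UNIV. scl (transition \<pi> t t' x $ a $ b) (\<eta> c t x b))"
  shows "\<eta> \<in> vforms \<A> \<pi> \<T> U L"
  unfolding vforms_def forms_def
  by (intro CollectI conjI allI ballI impI) (rule assms; assumption)+

lemma vforms_mono: "L \<subseteq> L' \<Longrightarrow> vforms \<A> \<pi> \<T> U L \<subseteq> vforms \<A> \<pi> \<T> U L'"
  unfolding vforms_def forms_def by blast

lemma connection_vforms: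
  assumes "connection \<A> \<pi> \<T> D" "open U" "s \<in> vforms \<A> \<pi> \<T> U (ext_deg 0)"
  shows "D U s \<in> vforms \<A> \<pi> \<T> U (ext_deg 1)"
proof -
  have "\<forall>s\<in>vforms \<A> \<pi> \<T> U (ext_deg 0). D U s \<in> vforms \<A> \<pi> \<T> U (ext_deg 1)"
    using assms(1,2) unfolding connection_def by simp
  with assms(3) show ?thesis by (rule bspec[rotated])
qed

lemma extends_connectionD:
  assumes "extends_connection \<A> \<pi> \<T> D N" "open U"
  shows extension_vforms: "\<eta> \<in> vforms \<A> \<pi> \<T> U (ext_deg k) \<Longrightarrow> N U \<eta> \<in> vforms \<A> \<pi> \<T> U (ext_deg (k + 1))"
    and extension_add: "\<eta> \<in> vforms \<A> \<pi> \<T> U (ext_deg k) \<Longrightarrow> \<zeta> \<in> vforms \<A> \<pi> \<T> U (ext_deg k) \<Longrightarrow>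
      N U (\<eta> + \<zeta>) = N U \<eta> + N U \<zeta>"
    and extension_restrict: "\<eta> \<in> vforms \<A> \<pi> \<T> U (ext_deg k) \<Longrightarrow> open W \<Longrightarrow> W \<subseteq> U \<Longrightarrow>
      N W (vrestrict W \<eta>) = vrestrict W (N U \<eta>)"
    and extension_leibniz: "\<tau> \<in> forms \<A> U (ext_deg k) \<Longrightarrow> s \<in> vforms \<A> \<pi> \<T> U (ext_deg 0) \<Longrightarrow>
      N U (vwedge \<tau> s) = vwedge (ext_d \<A> U \<tau>) s + vwedge (\<lambda>c x. scl ((-1) ^ k) (\<tau> c x)) (D U s)"
  using assms(1)[unfolded extends_connection_def, rule_format, OF assms(2), of k] by simp_all

lemma contract_eq_contract_at: "contract \<phi> \<eta> = (\<lambda>c t x a. contract_at (\<phi> c x) (\<eta> c t x a))"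
  by (simp add: contract_def contract_at_def)

context
  fixes \<A> :: "('m::topological_space, 'n::{finite,linorder}) chart set"
    and \<pi> :: "'e \<Rightarrow> 'm" and \<T> :: "('m, 'e, 'r::finite) triv set"
  assumes M: "complex_manifold \<A>" and V: "holomorphic_bundle \<A> \<pi> \<T>"
begin

lemma triv_open: "t \<in> \<T> \<Longrightarrow> open (cdom t)"
  using V unfolding holomorphic_bundle_def by blast

text \<open>An extension of the connection is specified only on smooth forms of a fixed degree, so this is what makes
the connection applicable to a contraction.\<close>

lemma contract_vforms:
  assumes \<phi>: "\<phi> \<in> tforms \<A> UNIV 1" and \<eta>: "\<eta> \<in> vforms \<A> \<pi> \<T> UNIV (ext_deg k)"
  shows "contract \<phi> \<eta> \<in> vforms \<A> \<pi> \<T> UNIV (ext_deg k)"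
  unfolding contract_eq_contract_at
proof (rule vformsI)
  fix c t x a
  assume "t \<notin> \<T>"
  then show "contract_at (\<phi> c x) (\<eta> c t x a) = 0" by (simp add: vforms_outside[OF \<eta>])
next
  fix c t x a
  assume "t \<in> \<T>" "c \<notin> \<A> \<or> x \<notin> UNIV \<inter> cdom t \<inter> cdom c"
  then have "\<eta> c t x a = 0" by (intro vforms_zero_outside[OF \<eta>]) auto
  then show "contract_at (\<phi> c x) (\<eta> c t x a) = 0" by simp
next
  fix c t x a
  assume "t \<in> \<T>"
  then show "contract_at (\<phi> c x) (\<eta> c t x a) \<in> ext_deg k"
    using forms_in[OF vforms_forms[OF \<eta>]] by (intro contract_at_deg dbar_one_form_deg tforms_bideg[OF \<phi>]) auto
next
  fix c t a
  assume t: "t \<in> \<T>" and c: "c \<in> \<A>"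
  have "smooth_ext c (UNIV \<inter> cdom t) (\<lambda>x. \<phi> c x i)" for i
    by (rule smooth_ext_subset[OF M c tforms_smooth[OF \<phi> c]]) simp
  then show "smooth_ext c (UNIV \<inter> cdom t) (\<lambda>x. contract_at (\<phi> c x) (\<eta> c t x a))"
    using forms_smooth[OF vforms_forms[OF \<eta> t] c] triv_open[OF t] by (intro smooth_ext_contract_at[OF M c]) auto
next
  fix c c' t x a
  assume t: "t \<in> \<T>" and c: "c \<in> \<A>" "c' \<in> \<A>" and x: "x \<in> UNIV \<inter> cdom t \<inter> cdom c \<inter> cdom c'"
  have "pull (jacobian c c' x) (contract_at (\<phi> c' x) (\<eta> c' t x a)) = contract_at (\<phi> c x) (pull (jacobian c c' x) (\<eta> c' t x a))"
    using x by (intro pull_contract_at tforms_pull[OF \<phi> c]) auto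
  then show "contract_at (\<phi> c x) (\<eta> c t x a) = pull (jacobian c c' x) (contract_at (\<phi> c' x) (\<eta> c' t x a))"
    using forms_pull[OF vforms_forms[OF \<eta> t] c x] by simp
next
  fix c t t' x a
  assume "c \<in> \<A>" "t \<in> \<T>" "t' \<in> \<T>" "x \<in> UNIV \<inter> cdom c \<inter> cdom t \<inter> cdom t'"
  then show "contract_at (\<phi> c x) (\<eta> c t' x a) =
      (\<Sum>b\<in>UNIV. scl (transition \<pi> t t' x $ a $ b) (contract_at (\<phi> c x) (\<eta> c t x b)))"
    by (simp add: vforms_transition[OF \<eta>, of c t t'] contract_at_sum contract_at_scl)
qed

lemma vwedge_vforms:
  assumes U: "open U" and \<tau>: "\<tau> \<in> forms \<A> U (ext_deg k)" and s: "s \<in> vforms \<A> \<pi> \<T> U (ext_deg l)"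
  shows "vwedge \<tau> s \<in> vforms \<A> \<pi> \<T> U (ext_deg (k + l))"
  unfolding vwedge_def
proof (rule vformsI)
  fix c t x a
  assume "t \<notin> \<T>"
  then show "\<tau> c x \<and>\<^sub>w s c t x a = 0" by (simp add: vforms_outside[OF s])
next
  fix c t x a
  assume "t \<in> \<T>" "c \<notin> \<A> \<or> x \<notin> U \<inter> cdom t \<inter> cdom c"
  then have "s c t x a = 0" by (intro vforms_zero_outside[OF s]) auto
  then show "\<tau> c x \<and>\<^sub>w s c t x a = 0" by simp
next
  fix c t x a
  assume "t \<in> \<T>"
  then show "\<tau> c x \<and>\<^sub>w s c t x a \<in> ext_deg (k + l)"
    by (intro wedge_deg forms_in[OF \<tau>] forms_in[OF vforms_forms[OF s]])
next
  fix c t a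
  assume t: "t \<in> \<T>" and c: "c \<in> \<A>"
  have "smooth_ext c (U \<inter> cdom t) (\<tau> c)"
    by (rule smooth_ext_subset[OF M c forms_smooth[OF \<tau> c]]) auto
  then show "smooth_ext c (U \<inter> cdom t) (\<lambda>x. \<tau> c x \<and>\<^sub>w s c t x a)"
    using forms_smooth[OF vforms_forms[OF s t] c] triv_open[OF t] U by (intro smooth_ext_wedge[OF M c]) auto
next
  fix c c' t x a
  assume t: "t \<in> \<T>" and c: "c \<in> \<A>" "c' \<in> \<A>" and x: "x \<in> U \<inter> cdom t \<inter> cdom c \<inter> cdom c'"
  then have "\<tau> c x = pull (jacobian c c' x) (\<tau> c' x)" by (intro forms_pull[OF \<tau> c]) auto
  then show "\<tau> c x \<and>\<^sub>w s c t x a = pull (jacobian c c' x) (\<tau> c' x \<and>\<^sub>w s c' t x a)"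
    using forms_pull[OF vforms_forms[OF s t] c x] by (simp add: pull_wedge)
next
  fix c t t' x a
  assume "c \<in> \<A>" "t \<in> \<T>" "t' \<in> \<T>" "x \<in> U \<inter> cdom c \<inter> cdom t \<inter> cdom t'"
  then show "\<tau> c x \<and>\<^sub>w s c t' x a =
      (\<Sum>b\<in>UNIV. scl (transition \<pi> t t' x $ a $ b) (\<tau> c x \<and>\<^sub>w s c t x b))"
    by (simp add: vforms_transition[OF s, of c t t'] wedge_sum_right wedge_scl_right)
qed

lemma vforms_zero: "0 \<in> vforms \<A> \<pi> \<T> U (ext_deg k)"
  by (rule vformsI)
    (simp_all add: fun_apply_simps lin_0[OF lin_pull] smooth_ext_iff[OF M] chart_smooth_const[OF M] ext_deg_closed)

lemma vforms_add:
  assumes U: "open U" and \<eta>: "\<eta> \<in> vforms \<A> \<pi> \<T> U (ext_deg k)" and \<zeta>: "\<zeta> \<in> vforms \<A> \<pi> \<T> U (ext_deg k)"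
  shows "\<eta> + \<zeta> \<in> vforms \<A> \<pi> \<T> U (ext_deg k)"
proof -
  have "(\<lambda>c t x a. \<eta> c t x a + \<zeta> c t x a) \<in> vforms \<A> \<pi> \<T> U (ext_deg k)"
  proof (rule vformsI)
    fix c t x a
    assume "t \<notin> \<T>"
    then show "\<eta> c t x a + \<zeta> c t x a = 0" by (simp add: vforms_outside[OF \<eta>] vforms_outside[OF \<zeta>])
  next
    fix c t x a
    assume "t \<in> \<T>" "c \<notin> \<A> \<or> x \<notin> U \<inter> cdom t \<inter> cdom c"
    then have "\<eta> c t x a = 0" "\<zeta> c t x a = 0"
      by (auto intro!: vforms_zero_outside[OF \<eta>] vforms_zero_outside[OF \<zeta>])
    then show "\<eta> c t x a + \<zeta> c t x a = 0" by simp
  next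
    fix c t x a
    assume "t \<in> \<T>"
    then show "\<eta> c t x a + \<zeta> c t x a \<in> ext_deg k"
      by (intro ext_deg_closed forms_in[OF vforms_forms[OF \<eta>]] forms_in[OF vforms_forms[OF \<zeta>]])
  next
    fix c t a
    assume t: "t \<in> \<T>" and c: "c \<in> \<A>"
    then show "smooth_ext c (U \<inter> cdom t) (\<lambda>x. \<eta> c t x a + \<zeta> c t x a)"
      using forms_smooth[OF vforms_forms[OF \<eta> t] c, of a] forms_smooth[OF vforms_forms[OF \<zeta> t] c, of a]
        triv_open[OF t] U
      unfolding smooth_ext_iff[OF M c] fun_apply_simps by (intro allI chart_smooth_add[OF M c]) auto
  next
    fix c c' t x a
    assume t: "t \<in> \<T>" and c: "c \<in> \<A>" "c' \<in> \<A>" and x: "x \<in> U \<inter> cdom t \<inter> cdom c \<inter> cdom c'"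
    then show "\<eta> c t x a + \<zeta> c t x a = pull (jacobian c c' x) (\<eta> c' t x a + \<zeta> c' t x a)"
      using forms_pull[OF vforms_forms[OF \<eta> t] c x] forms_pull[OF vforms_forms[OF \<zeta> t] c x]
      by (simp add: lin_add[OF lin_pull])
  next
    fix c t t' x a
    assume "c \<in> \<A>" "t \<in> \<T>" "t' \<in> \<T>" "x \<in> U \<inter> cdom c \<inter> cdom t \<inter> cdom t'"
    then show "\<eta> c t' x a + \<zeta> c t' x a =
        (\<Sum>b\<in>UNIV. scl (transition \<pi> t t' x $ a $ b) (\<eta> c t x b + \<zeta> c t x b))"
      by (simp add: vforms_transition[OF \<eta>, of c t t'] vforms_transition[OF \<zeta>, of c t t']
          scl_distrib sum.distrib)
  qed
  then show ?thesis by (simp add: plus_fun_def)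
qed

text \<open>Additivity on one space of forms only, hence the proof carries along that all partial sums lie in it.\<close>

lemma vforms_sum_additive:
  assumes U: "open U" and f: "\<And>b. f b \<in> vforms \<A> \<pi> \<T> U (ext_deg k)"
    and N: "\<And>\<eta> \<zeta>. \<eta> \<in> vforms \<A> \<pi> \<T> U (ext_deg k) \<Longrightarrow> \<zeta> \<in> vforms \<A> \<pi> \<T> U (ext_deg k) \<Longrightarrow>
      N (\<eta> + \<zeta>) = N \<eta> + (N \<zeta> :: ('m, 'n, 'e, 'r) vform)"
  shows "N (\<Sum>b\<in>B. f b) = (\<Sum>b\<in>B. N (f b))"
proof -
  have N0: "N 0 = 0" using N[OF vforms_zero vforms_zero] by simp
  have "(\<Sum>b\<in>B. f b) \<in> vforms \<A> \<pi> \<T> U (ext_deg k) \<and> N (\<Sum>b\<in>B. f b) = (\<Sum>b\<in>B. N (f b))"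
    by (induction B rule: infinite_finite_induct)
      (simp_all add: N0 vforms_zero N[OF f] vforms_add[OF U f])
  then show ?thesis by simp
qed

section \<open>Holomorphic frames and the local formula for the connection\<close>

lemma lift_in_fibre:
  assumes "t \<in> \<T>" "x \<in> cdom t"
  shows "\<pi> (lift \<pi> t x v) = x" "snd t (lift \<pi> t x v) = v"
proof -
  have b: "bij_betw (\<lambda>e. (\<pi> e, snd t e)) (\<pi> -` cdom t) (cdom t \<times> UNIV)"
    using V assms(1) unfolding holomorphic_bundle_def by blast
  then have "(x, v) \<in> (\<lambda>e. (\<pi> e, snd t e)) ` (\<pi> -` cdom t)"
    using assms(2) by (simp add: bij_betw_def)
  then obtain e where e: "\<pi> e = x" "snd t e = v" by auto
  have "e' = e" if "\<pi> e' = x \<and> snd t e' = v" for e'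
    using bij_betw_imp_inj_on[OF b] e that assms(2) by (auto simp: inj_on_def)
  with e have "\<exists>!e. \<pi> e = x \<and> snd t e = v" by blast
  from theI'[OF this] show "\<pi> (lift \<pi> t x v) = x" "snd t (lift \<pi> t x v) = v"
    unfolding lift_def by auto
qed

lemma transition_apply:
  assumes "t \<in> \<T>" "t' \<in> \<T>" "\<pi> e \<in> cdom t \<inter> cdom t'"
  shows "snd t' e = transition \<pi> t t' (\<pi> e) *v snd t e"
  using V assms unfolding holomorphic_bundle_def by blast

lemma transition_self:
  assumes "t \<in> \<T>" "x \<in> cdom t"
  shows "transition \<pi> t t x = mat 1"
  unfolding transition_def lift_in_fibre(2)[OF assms] by (simp add: matrix_def mat_def axis_def vec_eq_iff)

lemma transition_cocycle:
  assumes t: "t \<in> \<T>" "t' \<in> \<T>" "t'' \<in> \<T>" and x: "x \<in> cdom t \<inter> cdom t' \<inter> cdom t''"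
  shows "transition \<pi> t t'' x = transition \<pi> t' t'' x ** transition \<pi> t t' x"
  unfolding matrix_eq
proof
  fix v
  let ?e = "lift \<pi> t x v"
  have e: "\<pi> ?e = x" "snd t ?e = v" using lift_in_fibre[OF t(1)] x by auto
  then show "transition \<pi> t t'' x *v v = (transition \<pi> t' t'' x ** transition \<pi> t t' x) *v v"
    using transition_apply[of t t'' ?e] transition_apply[of t t' ?e] transition_apply[of t' t'' ?e] t x
    by (simp add: matrix_vector_mul_assoc[symmetric])
qed

text \<open>The section over \<open>cdom t\<close> whose coordinates in \<open>t\<close> are the \<open>b\<close>-th unit vector; in another trivialization
its coordinates are the \<open>b\<close>-th column of the transition matrix.\<close>

definition frame_section :: "('m, 'e, 'r) triv \<Rightarrow> 'r \<Rightarrow> ('m, 'n, 'e, 'r) vform" where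
  "frame_section t b = (\<lambda>c t' x a. if c \<in> \<A> \<and> t' \<in> \<T> \<and> x \<in> cdom t \<inter> cdom c \<inter> cdom t'
     then scalar (transition \<pi> t t' x $ a $ b) else 0)"

lemma frame_section_vforms:
  assumes t: "t \<in> \<T>"
  shows "frame_section t b \<in> vforms \<A> \<pi> \<T> (cdom t) (ext_deg 0)"
proof (rule vformsI)
  fix c x a and t' :: "('m, 'e, 'r) triv"
  assume "t' \<notin> \<T>"
  then show "frame_section t b c t' x a = 0" by (simp add: frame_section_def)
next
  fix c x a and t' :: "('m, 'e, 'r) triv"
  assume "c \<notin> \<A> \<or> x \<notin> cdom t \<inter> cdom t' \<inter> cdom c"
  then show "frame_section t b c t' x a = 0" by (auto simp: frame_section_def)
next
  fix c x a and t' :: "('m, 'e, 'r) triv"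
  show "frame_section t b c t' x a \<in> ext_deg 0"
    by (auto simp: frame_section_def ext_deg_def scalar_def fun_apply_simps split: if_splits)
next
  fix c a and t' :: "('m, 'e, 'r) triv"
  assume t': "t' \<in> \<T>" and c: "c \<in> \<A>"
  have "chart_smooth c (cdom t \<inter> cdom t') (\<lambda>x. transition \<pi> t t' x $ a $ b)"
    using V t t' c unfolding holomorphic_bundle_def hol_fun_def hol_on_def chart_smooth_def by blast
  then have "chart_smooth c (cdom t \<inter> cdom t') (\<lambda>x. scalar (transition \<pi> t t' x $ a $ b) S)" for S :: "'n cidx set"
    by (cases "S = {}") (simp_all add: scalar_def chart_smooth_const[OF M c])
  then have "smooth_ext c (cdom t \<inter> cdom t') (\<lambda>x. scalar (transition \<pi> t t' x $ a $ b))"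
    by (simp add: smooth_ext_iff[OF M c])
  then show "smooth_ext c (cdom t \<inter> cdom t') (\<lambda>x. frame_section t b c t' x a)"
    using triv_open[OF t] triv_open[OF t'] t' c
    by (elim smooth_ext_cong[OF M c, rotated 2]) (auto simp: frame_section_def)
next
  fix c c' x a and t' :: "('m, 'e, 'r) triv"
  assume "t' \<in> \<T>" "c \<in> \<A>" "c' \<in> \<A>" "x \<in> cdom t \<inter> cdom t' \<inter> cdom c \<inter> cdom c'"
  then show "frame_section t b c t' x a = pull (jacobian c c' x) (frame_section t b c' t' x a)"
    by (simp add: frame_section_def pull_scalar)
next
  fix c x a and t' t'' :: "('m, 'e, 'r) triv"
  assume "c \<in> \<A>" "t' \<in> \<T>" "t'' \<in> \<T>" "x \<in> cdom t \<inter> cdom c \<inter> cdom t' \<inter> cdom t''"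
  moreover from this have "transition \<pi> t t'' x $ a $ b =
      (\<Sum>d\<in>UNIV. transition \<pi> t' t'' x $ a $ d * transition \<pi> t t' x $ d $ b)"
    by (subst transition_cocycle[OF t, of t' t'']) (auto simp: matrix_matrix_mult_def)
  ultimately show "frame_section t b c t'' x a =
      (\<Sum>d\<in>UNIV. scl (transition \<pi> t' t'' x $ a $ d) (frame_section t b c t' x d))"
    by (intro ext) (simp add: frame_section_def scalar_def scl_def ext_sum_apply)
qed

lemma vrestrict_frame_expansion:
  assumes t: "t \<in> \<T>" and \<eta>: "\<eta> \<in> vforms \<A> \<pi> \<T> UNIV L"
  shows "vrestrict (cdom t) \<eta> = (\<Sum>b\<in>UNIV. vwedge (\<lambda>c x. \<eta> c t x b) (frame_section t b))"
proof (intro ext)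
  fix c t' x a S
  have "vrestrict (cdom t) \<eta> c t' x a = (\<Sum>b\<in>UNIV. \<eta> c t x b \<and>\<^sub>w frame_section t b c t' x a)"
  proof (cases "c \<in> \<A> \<and> t' \<in> \<T> \<and> x \<in> cdom t \<inter> cdom c \<inter> cdom t'")
    case True
    then show ?thesis
      using vforms_transition[OF \<eta>, of c t t' x a] t by (simp add: vrestrict_def frame_section_def)
  next
    case False
    then have "vrestrict (cdom t) \<eta> c t' x a = 0"
      by (auto simp: vrestrict_def intro!: vforms_zero_outside[OF \<eta>])
    with False show ?thesis by (auto simp: frame_section_def)
  qed
  then show "vrestrict (cdom t) \<eta> c t' x a S =
      (\<Sum>b\<in>UNIV. vwedge (\<lambda>c x. \<eta> c t x b) (frame_section t b)) c t' x a S"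
    by (simp add: vform_sum_apply vwedge_def)
qed

text \<open>Over \<open>cdom t\<close> the form is the sum of the products of its components with the frame sections, to which the
Leibniz rule applies.  Graded commutativity moves the 1-forms \<open>D e\<^sub>b\<close> to the left and absorbs the sign.\<close>

lemma nabla_local:
  assumes D: "connection \<A> \<pi> \<T> D" and N: "extends_connection \<A> \<pi> \<T> D N"
    and \<eta>: "\<eta> \<in> vforms \<A> \<pi> \<T> UNIV (ext_deg k)"
    and c: "c \<in> \<A>" and t: "t \<in> \<T>" and x: "x \<in> cdom c \<inter> cdom t"
  shows "N UNIV \<eta> c t x a = (\<Sum>i\<in>UNIV. gen i \<and>\<^sub>w ext_diff c i (\<lambda>y. \<eta> c t y a) x) +
    (\<Sum>b\<in>UNIV. D (cdom t) (frame_section t b) c t x a \<and>\<^sub>w \<eta> c t x b)"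
proof -
  let ?e = "frame_section t" and ?\<tau> = "\<lambda>b c x. \<eta> c t x b" and ?W = "cdom t"
  have W: "open ?W" by (rule triv_open[OF t])
  have e: "?e b \<in> vforms \<A> \<pi> \<T> ?W (ext_deg 0)" for b by (rule frame_section_vforms[OF t])
  have \<tau>: "?\<tau> b \<in> forms \<A> ?W (ext_deg k)" for b using vforms_forms[OF \<eta> t, of b] by simp
  have De: "D ?W (?e b) \<in> vforms \<A> \<pi> \<T> ?W (ext_deg 1)" for b
    by (rule connection_vforms[OF D W e])
  have "vrestrict ?W (N UNIV \<eta>) = N ?W (vrestrict ?W \<eta>)"
    by (rule extension_restrict[OF N open_UNIV \<eta> W subset_UNIV, symmetric])
  also have "\<dots> = N ?W (\<Sum>b\<in>UNIV. vwedge (?\<tau> b) (?e b))"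
    by (simp only: vrestrict_frame_expansion[OF t \<eta>])
  also have "\<dots> = (\<Sum>b\<in>UNIV. N ?W (vwedge (?\<tau> b) (?e b)))"
  proof (rule vforms_sum_additive[OF W])
    show "vwedge (?\<tau> b) (?e b) \<in> vforms \<A> \<pi> \<T> ?W (ext_deg k)" for b
      using vwedge_vforms[OF W \<tau> e] by simp
    show "N ?W (\<xi> + \<zeta>) = N ?W \<xi> + N ?W \<zeta>"
      if "\<xi> \<in> vforms \<A> \<pi> \<T> ?W (ext_deg k)" "\<zeta> \<in> vforms \<A> \<pi> \<T> ?W (ext_deg k)" for \<xi> \<zeta>
      by (rule extension_add[OF N W that])
  qed
  also have "\<dots> = (\<Sum>b\<in>UNIV. vwedge (ext_d \<A> ?W (?\<tau> b)) (?e b) +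
      vwedge (\<lambda>c x. scl ((-1) ^ k) (?\<tau> b c x)) (D ?W (?e b)))"
    by (intro sum.cong refl extension_leibniz[OF N W \<tau> e])
  finally have "vrestrict ?W (N UNIV \<eta>) c t x a = \<dots> c t x a" by simp
  then have "N UNIV \<eta> c t x a = (\<Sum>b\<in>UNIV. ext_d \<A> ?W (?\<tau> b) c x \<and>\<^sub>w ?e b c t x a +
      scl ((-1) ^ k) (\<eta> c t x b \<and>\<^sub>w D ?W (?e b) c t x a))"
    using x by (simp add: vrestrict_def vform_sum_apply vwedge_def fun_apply_simps wedge_scl_left)
  also have "\<dots> = (\<Sum>b\<in>UNIV. (if a = b then ext_d \<A> ?W (?\<tau> b) c x else 0) +
      D ?W (?e b) c t x a \<and>\<^sub>w \<eta> c t x b)"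
  proof (rule sum.cong[OF refl])
    fix b
    \<comment> \<open>The transition matrix from \<open>t\<close> to itself is the identity.\<close>
    have "?e b c t x a = (if a = b then scalar 1 else 0)"
      using x c t by (auto simp: frame_section_def transition_self mat_def scalar_def fun_apply_simps)
    then show "ext_d \<A> ?W (?\<tau> b) c x \<and>\<^sub>w ?e b c t x a + scl ((-1) ^ k) (\<eta> c t x b \<and>\<^sub>w D ?W (?e b) c t x a) =
       (if a = b then ext_d \<A> ?W (?\<tau> b) c x else 0) + D ?W (?e b) c t x a \<and>\<^sub>w \<eta> c t x b"
      using one_form_graded_comm[of "D ?W (?e b) c t x a" "\<eta> c t x b" k]
        forms_in[OF vforms_forms[OF De[of b] t, of a], of c x] forms_in[OF \<tau>[of b], of c x] by simp
  qed
  also have "\<dots> = ext_d \<A> ?W (?\<tau> a) c x + (\<Sum>b\<in>UNIV. D ?W (?e b) c t x a \<and>\<^sub>w \<eta> c t x b)"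
    by (simp add: sum.distrib)
  finally show ?thesis using x c by (simp add: ext_d_def)
qed

end

theorem corollary3p5:
  fixes \<A> :: "('m::{t2_space,second_countable_topology}, 'n::{finite,linorder}) chart set"
    and \<pi> :: "'e \<Rightarrow> 'm"
    and \<T> :: "('m, 'e, 'r::finite) triv set"
    and h :: "'e \<Rightarrow> 'e \<Rightarrow> complex"
    and D nabla :: "'m set \<Rightarrow> ('m, 'n, 'e, 'r) vform \<Rightarrow> ('m, 'n, 'e, 'r) vform"
    and \<eta> :: "('m, 'n, 'e, 'r) vform"
    and \<phi>\<^sub>1 \<phi>\<^sub>2 :: "('m, 'n) tform"
    and p q :: nat
  assumes "complex_manifold \<A>"
    and "holomorphic_bundle \<A> \<pi> \<T>"
    and "hermitian_metric \<A> \<pi> \<T> h"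
    and "chern_connection \<A> \<pi> \<T> h D"
    and "extends_connection \<A> \<pi> \<T> D nabla"
    and "\<eta> \<in> vforms \<A> \<pi> \<T> UNIV (ext_bideg p q)"
    and "\<phi>\<^sub>1 \<in> tforms \<A> UNIV 1"
    and "\<phi>\<^sub>2 \<in> tforms \<A> UNIV 1"
  shows "contract (bracket \<phi>\<^sub>1 \<phi>\<^sub>2) \<eta> =
    contract \<phi>\<^sub>1 (nabla UNIV (contract \<phi>\<^sub>2 \<eta>))
    - nabla UNIV (contract \<phi>\<^sub>2 (contract \<phi>\<^sub>1 \<eta>))
    + contract \<phi>\<^sub>2 (nabla UNIV (contract \<phi>\<^sub>1 \<eta>))
    - contract \<phi>\<^sub>2 (contract \<phi>\<^sub>1 (nabla UNIV \<eta>))"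
proof -
  note M = assms(1) and V = assms(2) and N = assms(5) and \<phi> = assms(7) and \<psi> = assms(8)
  have D: "connection \<A> \<pi> \<T> D" using assms(4) by (simp add: chern_connection_def)
  define k where "k = p + q"
  have \<eta>: "\<eta> \<in> vforms \<A> \<pi> \<T> UNIV (ext_deg k)"
    using assms(6) vforms_mono[OF ext_bideg_subset_deg[of p q], of \<A> \<pi> \<T> UNIV] unfolding k_def by (rule rev_subsetD)
  note con = contract_vforms[OF M V]
  have nab: "nabla UNIV \<zeta> \<in> vforms \<A> \<pi> \<T> UNIV (ext_deg (k + 1))"
    if "\<zeta> \<in> vforms \<A> \<pi> \<T> UNIV (ext_deg k)" for \<zeta>
    by (rule extension_vforms[OF N open_UNIV that])
  have "contract (bracket \<phi>\<^sub>1 \<phi>\<^sub>2) \<eta> c t x a = contract \<phi>\<^sub>1 (nabla UNIV (contract \<phi>\<^sub>2 \<eta>)) c t x a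
    - nabla UNIV (contract \<phi>\<^sub>2 (contract \<phi>\<^sub>1 \<eta>)) c t x a
    + contract \<phi>\<^sub>2 (nabla UNIV (contract \<phi>\<^sub>1 \<eta>)) c t x a
    - contract \<phi>\<^sub>2 (contract \<phi>\<^sub>1 (nabla UNIV \<eta>)) c t x a" for c t x a
  \<comment> \<open>Where the coordinate expressions make no sense, all terms have the default value 0.\<close>
  proof (cases "c \<in> \<A> \<and> t \<in> \<T> \<and> x \<in> cdom c \<inter> cdom t")
    case False
    have z: "\<zeta> c t x a = 0" if "\<zeta> \<in> vforms \<A> \<pi> \<T> UNIV (ext_deg l)" for \<zeta> l
      using False by (intro vforms_zero_outside[OF that]) auto
    show ?thesis
      by (simp add: contract_eq_contract_at[of "bracket \<phi>\<^sub>1 \<phi>\<^sub>2"] z[OF \<eta>] z[OF nab] z[OF con] con[OF \<phi>] con[OF \<psi>] nab \<eta>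
          z[OF con[OF \<phi> nab]] z[OF con[OF \<psi> nab]] z[OF con[OF \<psi> con[OF \<phi> nab]]])
  next
    case True
    then have c: "c \<in> \<A>" and t: "t \<in> \<T>" and x: "x \<in> cdom c \<inter> cdom t" by auto
    define d where "d = (\<lambda>(\<phi> :: ('m, 'n) tform) a i. ext_diff c a (\<lambda>y. \<phi> c y i) x)"
    define \<theta> where "\<theta> = (\<lambda>b. D (cdom t) (frame_section \<A> \<pi> \<T> t b) c t x a)"
    have W: "open (cdom t)" by (rule triv_open[OF M V t])
    have xW: "x \<in> cdom t \<inter> cdom c" using x by auto
    have \<theta>: "\<theta> b \<in> ext_deg 1" for b
    proof -
      have "D (cdom t) (frame_section \<A> \<pi> \<T> t b) \<in> vforms \<A> \<pi> \<T> (cdom t) (ext_deg 1)"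
        by (rule connection_vforms[OF D W frame_section_vforms[OF M V t]])
      from forms_in[OF vforms_forms[OF this t]] show ?thesis unfolding \<theta>_def .
    qed
    have s: "smooth_ext c (cdom t) (\<lambda>y. \<zeta> c t y a)" if "\<zeta> \<in> vforms \<A> \<pi> \<T> UNIV (ext_deg k)" for \<zeta>
      using forms_smooth[OF vforms_forms[OF that t] c] by simp
    have st: "smooth_ext c (cdom t) (\<lambda>y. \<phi> c y i)" if "\<phi> \<in> tforms \<A> UNIV 1" for \<phi> i
      by (rule smooth_ext_subset[OF M c tforms_smooth[OF that c]]) simp
    have dc: "ext_diff c i (\<lambda>y. contract \<phi> \<zeta> c t y a) x =
        contract_at (d \<phi> i) (\<zeta> c t x a) + contract_at (\<phi> c x) (ext_diff c i (\<lambda>y. \<zeta> c t y a) x)"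
      if "\<phi> \<in> tforms \<A> UNIV 1" "\<zeta> \<in> vforms \<A> \<pi> \<T> UNIV (ext_deg k)" for \<phi> \<zeta> i
      unfolding contract_eq_contract_at d_def by (rule ext_diff_contract_at[OF M c W xW st[OF that(1)] s[OF that(2)]])
    have nl: "nabla UNIV \<zeta> c t x a = (\<Sum>i\<in>UNIV. gen i \<and>\<^sub>w ext_diff c i (\<lambda>y. \<zeta> c t y a) x) +
        (\<Sum>b\<in>UNIV. \<theta> b \<and>\<^sub>w \<zeta> c t x b)" if "\<zeta> \<in> vforms \<A> \<pi> \<T> UNIV (ext_deg k)" for \<zeta>
      unfolding \<theta>_def by (rule nabla_local[OF M V D N that c t x])
    have db: "d \<phi> a i \<in> ext_bideg 0 1" if "\<phi> \<in> tforms \<A> UNIV 1" for \<phi> a i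
      unfolding d_def by (intro ext_diff_bideg[OF M c] tforms_bideg[OF that])
    have pointwise: "contract \<phi> \<zeta> c t x b = contract_at (\<phi> c x) (\<zeta> c t x b)" for \<phi> b and \<zeta> :: "('m, 'n, 'e, 'r) vform"
      by (simp add: contract_eq_contract_at)
    have br: "bracket \<phi>\<^sub>1 \<phi>\<^sub>2 c x =
        (\<lambda>j. \<Sum>i\<in>UNIV. \<phi>\<^sub>1 c x i \<and>\<^sub>w d \<phi>\<^sub>2 (Hol i) j + \<phi>\<^sub>2 c x i \<and>\<^sub>w d \<phi>\<^sub>1 (Hol i) j)"
      by (simp add: bracket_def d_def)
    show ?thesis
      unfolding pointwise br nl[OF \<eta>] nl[OF con[OF \<phi> \<eta>]] nl[OF con[OF \<psi> \<eta>]] nl[OF con[OF \<psi> con[OF \<phi> \<eta>]]]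
        dc[OF \<phi> \<eta>] dc[OF \<psi> \<eta>] dc[OF \<psi> con[OF \<phi> \<eta>]]
      by (rule contract_at_bracket) (intro tforms_bideg[OF \<phi>] tforms_bideg[OF \<psi>] db[OF \<phi>] db[OF \<psi>] \<theta>)+
  qed
  then show ?thesis by (intro ext) (simp add: fun_apply_simps)
qed

end
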